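(* Let $A/B$ be a depth two (D2) ring extension satisfying the double centralizer condition $C_A(C_A(B)) = B$. Let $R = C_A(B)$ and let $\mathcal{S} = (S,\Delta,\varepsilon)$ be the $R$-coring with $S=\mathrm{End}({}_BA_B)$ described in the context. Then $A/B$ is a split extension if and only if $\mathcal{S}$ is a cosplit $R$-coring.
   Context: Rings are associative and unital; $B$ is a unital subring of $A$. For a subset $X\subseteq A$, $C_A(X)$ is the centralizer of $X$ in $A$. Depth two: $A/B$ is D2 if $A\otimes_B A$ is isomorphic to a direct summand of a finite direct sum $A \oplus\cdots\oplus A$ as $B$-$A$-bimodules and also as $A$-$B$-bimodules (natural bimodule structures). Coring: for a ring $R'$, an $R'$-coring is an $R'$-$R'$-bimodule $\mathcal{C}$ with $R'$-$R'$-bimodule maps $\Delta:\mathcal{C}\to\mathcal{C}\otimes_{R'}\mathcal{C}$ (coassociative) and $\varepsilon:\mathcal{C}\to R'$ (counit). The $R$-coring $\mathcal{S}$: $S=\mathrm{End}({}_BA_B)$ with bimodule structure $(r\cdot\alpha\cdot r')(a) = r\alpha(a)r'$ for $r,r'\in R$, $\alpha\in S$, $a\in A$. For a D2 extension, $S\otimes_R S\cong \mathrm{Hom}_{B\text{-}B}(A\otimes_B A, A)$ via $\alpha\otimes\beta\mapsto(a\otimes a'\mapsto\alpha(a)\beta(a'))$; under this identification the coproduct is $\Delta(\alpha)(a\otimes a') = \alpha(aa')$. The counit is $\varepsilon(\alpha) = \alpha(1)$. An $R'$-coring $\mathcal{C}$ is cosplit if there is $e\in\mathcal{C}^{R'}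 = \{c\in\mathcal{C} : rc = cr\ \forall r\in R'\}$ with $\varepsilon(e) = 1$. The ring extension $A/B$ is split if there is a $B$-$B$-bimodule epimorphism $E:A\to B$ with $E(1)=1$. *)

theory Defs
  imports "HOL-Algebra.Free_Abelian_Groups" "HOL-Algebra.Subrings" "HOL-Algebra.AbelCoset"
begin

section \<open>Bimodules over noncommutative rings\<close>

text \<open>As for the library's modules, only the additive part of the underlying ring record of a
  bimodule is meaningful; the fields \<open>mult\<close> and \<open>one\<close> are not used.\<close>

record ('r, 'm, 's) bimodule = "('r, 'm) module" +
  rsmult :: "'m \<Rightarrow> 's \<Rightarrow> 'm" (infixl \<open>\<triangleleft>\<index>\<close> 70)

locale bimodule = L: ring L + R: ring R + M: abelian_group M
  for L :: "('r, 'x) ring_scheme" and R :: "('s, 'y) ring_scheme"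
    and M :: "('r, 'm, 's, 'z) bimodule_scheme" +
  assumes smult_closed:
      "\<lbrakk>a \<in> carrier L; x \<in> carrier M\<rbrakk> \<Longrightarrow> a \<odot>\<^bsub>M\<^esub> x \<in> carrier M"
    and smult_l_distr:
      "\<lbrakk>a \<in> carrier L; b \<in> carrier L; x \<in> carrier M\<rbrakk> \<Longrightarrow>
        (a \<oplus>\<^bsub>L\<^esub> b) \<odot>\<^bsub>M\<^esub> x = (a \<odot>\<^bsub>M\<^esub> x) \<oplus>\<^bsub>M\<^esub> (b \<odot>\<^bsub>M\<^esub> x)"
    and smult_r_distr:
      "\<lbrakk>a \<in> carrier L; x \<in> carrier M; y \<in> carrier M\<rbrakk> \<Longrightarrow>
        a \<odot>\<^bsub>M\<^esub> (x \<oplus>\<^bsub>M\<^esub> y) = (a \<odot>\<^bsub>M\<^esub> x) \<oplus>\<^bsub>M\<^esub> (a \<odot>\<^bsub>M\<^esub> y)"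
    and smult_assoc:
      "\<lbrakk>a \<in> carrier L; b \<in> carrier L; x \<in> carrier M\<rbrakk> \<Longrightarrow>
        (a \<otimes>\<^bsub>L\<^esub> b) \<odot>\<^bsub>M\<^esub> x = a \<odot>\<^bsub>M\<^esub> (b \<odot>\<^bsub>M\<^esub> x)"
    and smult_one:
      "x \<in> carrier M \<Longrightarrow> \<one>\<^bsub>L\<^esub> \<odot>\<^bsub>M\<^esub> x = x"
    and rsmult_closed:
      "\<lbrakk>x \<in> carrier M; r \<in> carrier R\<rbrakk> \<Longrightarrow> x \<triangleleft>\<^bsub>M\<^esub> r \<in> carrier M"
    and rsmult_r_distr:
      "\<lbrakk>x \<in> carrier M; r \<in> carrier R; s \<in> carrier R\<rbrakk> \<Longrightarrow>
        x \<triangleleft>\<^bsub>M\<^esub> (r \<oplus>\<^bsub>R\<^esub> s) = (x \<triangleleft>\<^bsub>M\<^esub> r) \<oplus>\<^bsub>M\<^esub> (x \<triangleleft>\<^bsub>M\<^esub> s)"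
    and rsmult_l_distr:
      "\<lbrakk>x \<in> carrier M; y \<in> carrier M; r \<in> carrier R\<rbrakk> \<Longrightarrow>
        (x \<oplus>\<^bsub>M\<^esub> y) \<triangleleft>\<^bsub>M\<^esub> r = (x \<triangleleft>\<^bsub>M\<^esub> r) \<oplus>\<^bsub>M\<^esub> (y \<triangleleft>\<^bsub>M\<^esub> r)"
    and rsmult_assoc:
      "\<lbrakk>x \<in> carrier M; r \<in> carrier R; s \<in> carrier R\<rbrakk> \<Longrightarrow>
        x \<triangleleft>\<^bsub>M\<^esub> (r \<otimes>\<^bsub>R\<^esub> s) = (x \<triangleleft>\<^bsub>M\<^esub> r) \<triangleleft>\<^bsub>M\<^esub> s"
    and rsmult_one:
      "x \<in> carrier M \<Longrightarrow> x \<triangleleft>\<^bsub>M\<^esub> \<one>\<^bsub>R\<^esub> = x"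
    and smult_rsmult:
      "\<lbrakk>a \<in> carrier L; x \<in> carrier M; r \<in> carrier R\<rbrakk> \<Longrightarrow>
        (a \<odot>\<^bsub>M\<^esub> x) \<triangleleft>\<^bsub>M\<^esub> r = a \<odot>\<^bsub>M\<^esub> (x \<triangleleft>\<^bsub>M\<^esub> r)"

definition bimodule_hom ::
  "('r, 'x) ring_scheme \<Rightarrow> ('s, 'y) ring_scheme \<Rightarrow> ('r, 'm, 's, 'z) bimodule_scheme \<Rightarrow>
    ('r, 'n, 's, 'w) bimodule_scheme \<Rightarrow> ('m \<Rightarrow> 'n) set" where
  "bimodule_hom L R M N =
    {f \<in> carrier M \<rightarrow> carrier N.
      (\<forall>x\<in>carrier M. \<forall>y\<in>carrier M. f (x \<oplus>\<^bsub>M\<^esub> y) = f x \<oplus>\<^bsub>N\<^esub> f y) \<and>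
      (\<forall>a\<in>carrier L. \<forall>x\<in>carrier M. f (a \<odot>\<^bsub>M\<^esub> x) = a \<odot>\<^bsub>N\<^esub> f x) \<and>
      (\<forall>x\<in>carrier M. \<forall>a\<in>carrier R. f (x \<triangleleft>\<^bsub>M\<^esub> a) = f x \<triangleleft>\<^bsub>N\<^esub> a)}"

definition bimodule_isomorphic ::
  "('r, 'x) ring_scheme \<Rightarrow> ('s, 'y) ring_scheme \<Rightarrow> ('r, 'm, 's, 'z) bimodule_scheme \<Rightarrow>
    ('r, 'n, 's, 'w) bimodule_scheme \<Rightarrow> bool" where
  "bimodule_isomorphic L R M N \<longleftrightarrow>
    (\<exists>f \<in> bimodule_hom L R M N. bij_betw f (carrier M) (carrier N))"

definition subbimodule ::
  "('r, 'x) ring_scheme \<Rightarrow> ('s, 'y) ring_scheme \<Rightarrow> 'm set \<Rightarrow>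
    ('r, 'm, 's, 'z) bimodule_scheme \<Rightarrow> bool" where
  "subbimodule L R P M \<longleftrightarrow> additive_subgroup P M \<and>
    (\<forall>a\<in>carrier L. \<forall>x\<in>P. a \<odot>\<^bsub>M\<^esub> x \<in> P) \<and> (\<forall>x\<in>P. \<forall>a\<in>carrier R. x \<triangleleft>\<^bsub>M\<^esub> a \<in> P)"

definition direct_summand ::
  "('r, 'x) ring_scheme \<Rightarrow> ('s, 'y) ring_scheme \<Rightarrow> 'm set \<Rightarrow>
    ('r, 'm, 's, 'z) bimodule_scheme \<Rightarrow> bool" where
  "direct_summand L R P M \<longleftrightarrow> subbimodule L R P M \<and>
    (\<exists>Q. subbimodule L R Q M \<and> P \<inter> Q = {\<zero>\<^bsub>M\<^esub>} \<and> P <+>\<^bsub>M\<^esub> Q = carrier M)"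

definition isomorphic_to_direct_summand ::
  "('r, 'x) ring_scheme \<Rightarrow> ('s, 'y) ring_scheme \<Rightarrow> ('r, 'm, 's, 'z) bimodule_scheme \<Rightarrow>
    ('r, 'n, 's, 'w) bimodule_scheme \<Rightarrow> bool" where
  "isomorphic_to_direct_summand L R M N \<longleftrightarrow>
    (\<exists>P. direct_summand L R P N \<and> bimodule_isomorphic L R M (N\<lparr>carrier := P\<rparr>))"

definition direct_power ::
  "nat \<Rightarrow> ('r, 'm, 's, 'z) bimodule_scheme \<Rightarrow> ('r, nat \<Rightarrow> 'm, 's) bimodule" where
  "direct_power n M =
    \<lparr>carrier = {..<n} \<rightarrow>\<^sub>E carrier M, monoid.mult = undefined, one = undefined,
     ring.zero = (\<lambda>i\<in>{..<n}. \<zero>\<^bsub>M\<^esub>), add = (\<lambda>x y. \<lambda>i\<in>{..<n}. x i \<oplus>\<^bsub>M\<^esub> y i),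
     smult = (\<lambda>a x. \<lambda>i\<in>{..<n}. a \<odot>\<^bsub>M\<^esub> x i), rsmult = (\<lambda>x a. \<lambda>i\<in>{..<n}. x i \<triangleleft>\<^bsub>M\<^esub> a)\<rparr>"

text \<open>The natural bimodule structure of a ring over any two of its subrings; which subrings act
  is determined by the rings handed to the predicates above.\<close>

definition regular_bimodule :: "('a, 'x) ring_scheme \<Rightarrow> ('a, 'a, 'a) bimodule" where
  "regular_bimodule A =
    \<lparr>carrier = carrier A, monoid.mult = (\<otimes>\<^bsub>A\<^esub>), one = \<one>\<^bsub>A\<^esub>, ring.zero = \<zero>\<^bsub>A\<^esub>, add = (\<oplus>\<^bsub>A\<^esub>),
     smult = (\<otimes>\<^bsub>A\<^esub>), rsmult = (\<otimes>\<^bsub>A\<^esub>)\<rparr>"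


section \<open>Tensor products\<close>

text \<open>\<open>M \<otimes>\<^sub>R N\<close> is the free abelian group on \<open>M \<times> N\<close> modulo the subgroup generated
  by the usual relations, so that its elements are cosets of formal sums of pairs.\<close>

type_synonym ('m, 'n) tensor = "('m \<times> 'n \<Rightarrow>\<^sub>0 int) set"

definition tensor_relations ::
  "('s, 'x) ring_scheme \<Rightarrow> ('r, 'm, 's, 'z) bimodule_scheme \<Rightarrow>
    ('s, 'n, 't, 'w) bimodule_scheme \<Rightarrow> ('m \<times> 'n \<Rightarrow>\<^sub>0 int) set" where
  "tensor_relations R M N =
    {frag_of (x \<oplus>\<^bsub>M\<^esub> x', y) - frag_of (x, y) - frag_of (x', y) | x x' y.
      x \<in> carrier M \<and> x' \<in> carrier M \<and> y \<in> carrier N} \<union>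
    {frag_of (x, y \<oplus>\<^bsub>N\<^esub> y') - frag_of (x, y) - frag_of (x, y') | x y y'.
      x \<in> carrier M \<and> y \<in> carrier N \<and> y' \<in> carrier N} \<union>
    {frag_of (x \<triangleleft>\<^bsub>M\<^esub> r, y) - frag_of (x, r \<odot>\<^bsub>N\<^esub> y) | x r y.
      x \<in> carrier M \<and> r \<in> carrier R \<and> y \<in> carrier N}"

definition tensor_kernel ::
  "('s, 'x) ring_scheme \<Rightarrow> ('r, 'm, 's, 'z) bimodule_scheme \<Rightarrow>
    ('s, 'n, 't, 'w) bimodule_scheme \<Rightarrow> ('m \<times> 'n \<Rightarrow>\<^sub>0 int) set" where
  "tensor_kernel R M N =
    generate (free_Abelian_group (carrier M \<times> carrier N)) (tensor_relations R M N)"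

definition tensor_group ::
  "('s, 'x) ring_scheme \<Rightarrow> ('r, 'm, 's, 'z) bimodule_scheme \<Rightarrow>
    ('s, 'n, 't, 'w) bimodule_scheme \<Rightarrow> ('m, 'n) tensor monoid" where
  "tensor_group R M N =
    free_Abelian_group (carrier M \<times> carrier N) Mod tensor_kernel R M N"

definition pure_tensor ::
  "('s, 'x) ring_scheme \<Rightarrow> ('r, 'm, 's, 'z) bimodule_scheme \<Rightarrow>
    ('s, 'n, 't, 'w) bimodule_scheme \<Rightarrow> 'm \<Rightarrow> 'n \<Rightarrow> ('m, 'n) tensor" where
  "pure_tensor R M N x y =
    tensor_kernel R M N #>\<^bsub>free_Abelian_group (carrier M \<times> carrier N)\<^esub> frag_of (x, y)"

text \<open>The homomorphism into the additive group of \<open>G\<close> that a balanced biadditive map \<open>\<phi>\<close> induces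
  on the tensor product: the class of the formal sum of the \<open>k\<^sub>i (x\<^sub>i, y\<^sub>i)\<close> is sent to the sum of
  the \<open>k\<^sub>i \<phi> x\<^sub>i y\<^sub>i\<close>. For balanced \<open>\<phi>\<close> this is independent of the representative; the value is
  unspecified otherwise.\<close>

definition tensor_lift ::
  "('c, 'z) ring_scheme \<Rightarrow> ('m \<Rightarrow> 'n \<Rightarrow> 'c) \<Rightarrow> ('m, 'n) tensor \<Rightarrow> 'c" where
  "tensor_lift G \<phi> X =
    the_elem ((\<lambda>c. \<Oplus>\<^bsub>G\<^esub>p\<in>Poly_Mapping.keys c.
      [Poly_Mapping.lookup c p] \<cdot>\<^bsub>G\<^esub> \<phi> (fst p) (snd p)) ` X)"

text \<open>For an \<open>L\<close>-\<open>R\<close>-bimodule \<open>M\<close> and an \<open>R\<close>-\<open>T\<close>-bimodule \<open>N\<close>, the outer actions make the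
  tensor product an \<open>L\<close>-\<open>T\<close>-bimodule.\<close>

definition tensor_ring ::
  "('s, 'x) ring_scheme \<Rightarrow> ('r, 'm, 's, 'z) bimodule_scheme \<Rightarrow>
    ('s, 'n, 't, 'w) bimodule_scheme \<Rightarrow> ('m, 'n) tensor ring" where
  "tensor_ring R M N =
    \<lparr>carrier = carrier (tensor_group R M N), monoid.mult = undefined, one = undefined,
     ring.zero = \<one>\<^bsub>tensor_group R M N\<^esub>, add = (\<otimes>\<^bsub>tensor_group R M N\<^esub>)\<rparr>"

definition tensor_product ::
  "('s, 'x) ring_scheme \<Rightarrow> ('r, 'm, 's, 'z) bimodule_scheme \<Rightarrow>
    ('s, 'n, 't, 'w) bimodule_scheme \<Rightarrow> ('r, ('m, 'n) tensor, 't) bimodule" where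
  "tensor_product R M N = ring.extend (tensor_ring R M N)
    \<lparr>smult = (\<lambda>l. tensor_lift (tensor_ring R M N) (\<lambda>x y. pure_tensor R M N (l \<odot>\<^bsub>M\<^esub> x) y)),
     rsmult = (\<lambda>X t. tensor_lift (tensor_ring R M N) (\<lambda>x y. pure_tensor R M N x (y \<triangleleft>\<^bsub>N\<^esub> t)) X)\<rparr>"

definition tensor_map ::
  "('s, 'x) ring_scheme \<Rightarrow> ('r, 'm, 's, 'z) bimodule_scheme \<Rightarrow>
    ('s, 'n, 't, 'w) bimodule_scheme \<Rightarrow> ('p \<Rightarrow> 'm) \<Rightarrow> ('q \<Rightarrow> 'n) \<Rightarrow>
    ('p, 'q) tensor \<Rightarrow> ('m, 'n) tensor" where
  "tensor_map R M N f g =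
    tensor_lift (tensor_product R M N) (\<lambda>x y. pure_tensor R M N (f x) (g y))"

text \<open>The canonical map \<open>(M \<otimes>\<^sub>R N) \<otimes>\<^sub>S P \<rightarrow> M \<otimes>\<^sub>R (N \<otimes>\<^sub>S P)\<close>.\<close>

definition tensor_assoc ::
  "('s, 'x) ring_scheme \<Rightarrow> ('t, 'y) ring_scheme \<Rightarrow> ('r, 'm, 's, 'z) bimodule_scheme \<Rightarrow>
    ('s, 'n, 't, 'w) bimodule_scheme \<Rightarrow> ('t, 'p, 'u, 'v) bimodule_scheme \<Rightarrow>
    (('m, 'n) tensor, 'p) tensor \<Rightarrow> ('m, ('n, 'p) tensor) tensor" where
  "tensor_assoc R S M N P =
    (let T = tensor_product R M (tensor_product S N P) in
      tensor_lift T (\<lambda>X z. tensor_lift T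
        (\<lambda>x y. pure_tensor R M (tensor_product S N P) x (pure_tensor S N P y z)) X))"


section \<open>Corings\<close>

record ('r, 'm) coring = "('r, 'm, 'r) bimodule" +
  comult :: "'m \<Rightarrow> ('m, 'm) tensor"
  counit :: "'m \<Rightarrow> 'r"

locale coring = bimodule R R C
  for R :: "('r, 'x) ring_scheme" and C :: "('r, 'm, 'z) coring_scheme" +
  assumes comult_hom: "comult C \<in> bimodule_hom R R C (tensor_product R C C)"
    and counit_hom: "counit C \<in> bimodule_hom R R C (regular_bimodule R)"
    and coassociative:
      "c \<in> carrier C \<Longrightarrow>
        tensor_assoc R R C C C (tensor_map R (tensor_product R C C) C (comult C) id (comult C c)) =
        tensor_map R C (tensor_product R C C) id (comult C) (comult C c)"
    and counit_left:
      "c \<in> carrier C \<Longrightarrow> tensor_lift C (\<lambda>x y. counit C x \<odot>\<^bsub>C\<^esub> y) (comult C c) = c"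
    and counit_right:
      "c \<in> carrier C \<Longrightarrow> tensor_lift C (\<lambda>x y. x \<triangleleft>\<^bsub>C\<^esub> counit C y) (comult C c) = c"

definition bimodule_invariants ::
  "('r, 'x) ring_scheme \<Rightarrow> ('r, 'm, 'r, 'z) bimodule_scheme \<Rightarrow> 'm set" where
  "bimodule_invariants R M = {c \<in> carrier M. \<forall>r\<in>carrier R. r \<odot>\<^bsub>M\<^esub> c = c \<triangleleft>\<^bsub>M\<^esub> r}"

definition cosplit_coring ::
  "('r, 'x) ring_scheme \<Rightarrow> ('r, 'm, 'z) coring_scheme \<Rightarrow> bool" where
  "cosplit_coring R C \<longleftrightarrow>
    coring R C \<and> (\<exists>e \<in> bimodule_invariants R C. counit C e = \<one>\<^bsub>R\<^esub>)"


section \<open>Depth two, split extensions and the endomorphism coring\<close>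

text \<open>A subset \<open>B\<close> of the ring \<open>A\<close> is turned into a ring by \<open>A\<lparr>carrier := B\<rparr>\<close>.\<close>

definition centralizer :: "('a, 'x) ring_scheme \<Rightarrow> 'a set \<Rightarrow> 'a set" where
  "centralizer A X = {a \<in> carrier A. \<forall>x\<in>X. a \<otimes>\<^bsub>A\<^esub> x = x \<otimes>\<^bsub>A\<^esub> a}"

definition tensor_square ::
  "('a, 'x) ring_scheme \<Rightarrow> 'a set \<Rightarrow> ('a, ('a, 'a) tensor, 'a) bimodule" where
  "tensor_square A B =
    tensor_product (A\<lparr>carrier := B\<rparr>) (regular_bimodule A) (regular_bimodule A)"

definition depth_two :: "('a, 'x) ring_scheme \<Rightarrow> 'a set \<Rightarrow> bool" where
  "depth_two A B \<longleftrightarrow>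
    (\<exists>n. isomorphic_to_direct_summand (A\<lparr>carrier := B\<rparr>) A
      (tensor_square A B) (direct_power n (regular_bimodule A))) \<and>
    (\<exists>n. isomorphic_to_direct_summand A (A\<lparr>carrier := B\<rparr>)
      (tensor_square A B) (direct_power n (regular_bimodule A)))"

definition split_extension :: "('a, 'x) ring_scheme \<Rightarrow> 'a set \<Rightarrow> bool" where
  "split_extension A B \<longleftrightarrow>
    (\<exists>E \<in> bimodule_hom (A\<lparr>carrier := B\<rparr>) (A\<lparr>carrier := B\<rparr>)
        (regular_bimodule A) (regular_bimodule (A\<lparr>carrier := B\<rparr>)).
      E ` carrier A = B \<and> E \<one>\<^bsub>A\<^esub> = \<one>\<^bsub>A\<^esub>)"

text \<open>The group of \<open>B\<close>-\<open>B\<close>-bimodule maps \<open>M \<rightarrow> A\<close>, with the actions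
  \<open>(r \<cdot> f \<cdot> r') m = r f(m) r'\<close> of the centralizer of \<open>B\<close>. Maps are made extensional so that they
  are determined by their values on the carrier of \<open>M\<close>.\<close>

definition hom_bimodule ::
  "('a, 'x) ring_scheme \<Rightarrow> 'a set \<Rightarrow> ('a, 'm, 'a, 'z) bimodule_scheme \<Rightarrow>
    ('a, 'm \<Rightarrow> 'a, 'a) bimodule" where
  "hom_bimodule A B M =
    \<lparr>carrier = bimodule_hom (A\<lparr>carrier := B\<rparr>) (A\<lparr>carrier := B\<rparr>) M (regular_bimodule A) \<inter>
       extensional (carrier M),
     monoid.mult = undefined, one = undefined,
     ring.zero = (\<lambda>m\<in>carrier M. \<zero>\<^bsub>A\<^esub>), add = (\<lambda>f g. \<lambda>m\<in>carrier M. f m \<oplus>\<^bsub>A\<^esub> g m),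
     smult = (\<lambda>r f. \<lambda>m\<in>carrier M. r \<otimes>\<^bsub>A\<^esub> f m), rsmult = (\<lambda>f r. \<lambda>m\<in>carrier M. f m \<otimes>\<^bsub>A\<^esub> r)\<rparr>"

definition End_bimodule :: "('a, 'x) ring_scheme \<Rightarrow> 'a set \<Rightarrow> ('a, 'a \<Rightarrow> 'a, 'a) bimodule" where
  "End_bimodule A B = hom_bimodule A B (regular_bimodule A)"

text \<open>With \<open>S = End(\<^sub>BA\<^sub>B)\<close> and \<open>R\<close> the centralizer of \<open>B\<close>, the canonical map
  \<open>S \<otimes>\<^sub>R S \<rightarrow> Hom\<^sub>B\<^sub>-\<^sub>B(A \<otimes>\<^sub>B A, A)\<close> sending \<open>\<alpha> \<otimes> \<beta>\<close> to \<open>a \<otimes> a' \<mapsto> \<alpha>(a) \<beta>(a')\<close>.\<close>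

definition End_tensor_to_Hom ::
  "('a, 'x) ring_scheme \<Rightarrow> 'a set \<Rightarrow> ('a \<Rightarrow> 'a, 'a \<Rightarrow> 'a) tensor \<Rightarrow> ('a, 'a) tensor \<Rightarrow> 'a" where
  "End_tensor_to_Hom A B = tensor_lift (hom_bimodule A B (tensor_square A B))
    (\<lambda>\<alpha> \<beta>. \<lambda>X\<in>carrier (tensor_square A B). tensor_lift A (\<lambda>a a'. \<alpha> a \<otimes>\<^bsub>A\<^esub> \<beta> a') X)"

text \<open>The comultiplication sends \<open>\<alpha>\<close> to the element of \<open>S \<otimes>\<^sub>R S\<close> that corresponds to
  \<open>a \<otimes> a' \<mapsto> \<alpha>(a a')\<close> under the canonical map, which is bijective for depth two extensions.\<close>

definition End_coring :: "('a, 'x) ring_scheme \<Rightarrow> 'a set \<Rightarrow> ('a, 'a \<Rightarrow> 'a) coring" where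
  "End_coring A B = bimodule.extend (End_bimodule A B)
    \<lparr>comult = (\<lambda>\<alpha>. inv_into
       (carrier (tensor_product (A\<lparr>carrier := centralizer A B\<rparr>) (End_bimodule A B) (End_bimodule A B)))
       (End_tensor_to_Hom A B)
       (\<lambda>X\<in>carrier (tensor_square A B). tensor_lift A (\<lambda>a a'. \<alpha> (a \<otimes>\<^bsub>A\<^esub> a')) X)),
     counit = (\<lambda>\<alpha>. \<alpha> \<one>\<^bsub>A\<^esub>)\<rparr>"

end

theory Submission
  imports Defs
begin

text \<open>A retraction of \<open>A\<^sup>n\<close> onto \<open>A \<otimes>\<^sub>B A\<close> as \<open>A\<close>-\<open>B\<close>-bimodules amounts to a quasi-basis: maps
  \<open>\<gamma>\<^sub>j \<in> S\<close> and \<open>B\<close>-central elements \<open>u\<^sub>j\<close> of \<open>A \<otimes>\<^sub>B A\<close> with \<open>1 \<otimes> a = \<Sum> \<gamma>\<^sub>j(a) u\<^sub>j\<close>. Contracting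
  with a left \<open>B\<close>-linear \<open>\<phi>\<close> gives \<open>\<phi>(a) = \<Sum> \<gamma>\<^sub>j(a) u\<^sub>j\<^sup>1 \<phi>(u\<^sub>j\<^sup>2)\<close>. For \<open>\<phi> = \<alpha> \<in> S\<close> the coefficients
  lie in \<open>R\<close>, so the \<open>\<gamma>\<^sub>j\<close> form a dual basis of the right \<open>R\<close>-module \<open>S\<close>, and an element of
  \<open>S \<otimes>\<^sub>R N\<close> is determined by its values under sufficiently many maps \<open>\<alpha> \<otimes> y \<mapsto> \<alpha>(a) e(y)\<close>.
  For \<open>\<phi> = F(- \<otimes> b)\<close> with \<open>F \<in> Hom\<^sub>B\<^sub>-\<^sub>B(A \<otimes>\<^sub>B A, A)\<close> the coefficients are elements of \<open>S\<close> as functions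
  of \<open>b\<close>, so the canonical map \<open>S \<otimes>\<^sub>R S \<rightarrow> Hom\<^sub>B\<^sub>-\<^sub>B(A \<otimes>\<^sub>B A, A)\<close> is onto. Hence \<open>\<Delta>\<close> is characterised
  by \<open>\<Sum> \<alpha>\<^sub>1(a) \<alpha>\<^sub>2(b) = \<alpha>(a b)\<close>, and the coring axioms are checked on values.

  An element \<open>e \<in> S\<close> commutes with \<open>R\<close> iff it takes values in \<open>C\<^sub>A(R) = B\<close>; together with
  \<open>e(1) = 1\<close> this says that \<open>e\<close> is a bimodule projection of \<open>A\<close> onto \<open>B\<close>.\<close>


section \<open>Tensor products of bimodules\<close>

context abelian_group
begin

text \<open>With f p = \<open>\<phi> (fst p) (snd p)\<close> this is the very expression whose image
  over a coset \<open>tensor_lift\<close> collects, so facts about it transfer to lifts.\<close>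

definition formal_sum :: "('c \<Rightarrow> 'a) \<Rightarrow> ('c \<Rightarrow>\<^sub>0 int) \<Rightarrow> 'a" where
  "formal_sum f c = (\<Oplus>p\<in>Poly_Mapping.keys c. [Poly_Mapping.lookup c p] \<cdot> f p)"

lemma int_add_pow_zero: "[(0::int)] \<cdot> x = \<zero>"
  by (simp add: add_pow_def)

text \<open>Points outside the support have coefficient zero and contribute zero. Formal sums with
  different supports can therefore be compared over one index set.\<close>

lemma formal_sum_superset:
  assumes "finite U" "Poly_Mapping.keys c \<subseteq> U" "f \<in> U \<rightarrow> carrier G"
  shows "formal_sum f c = (\<Oplus>p\<in>U. [Poly_Mapping.lookup c p] \<cdot> f p)"
  unfolding formal_sum_def
  by (rule add.finprod_mono_neutral_cong_left)
    (use assms in \<open>auto simp: in_keys_iff Pi_iff int_add_pow_zero intro!: add.int_pow_closed\<close>)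

lemma formal_sum_hom:
  assumes f: "f \<in> S \<rightarrow> carrier G"
  shows "formal_sum f \<in> hom (free_Abelian_group S) (add_monoid G)"
proof (rule homI)
  fix c assume "c \<in> carrier (free_Abelian_group S)"
  then show "formal_sum f c \<in> carrier (add_monoid G)"
    using f by (auto simp: formal_sum_def Pi_iff intro!: finsum_closed add.int_pow_closed)
next
  fix c d assume cd: "c \<in> carrier (free_Abelian_group S)" "d \<in> carrier (free_Abelian_group S)"
  \<comment> \<open>Cancellation can make the support of c + d smaller than this union, so all three
    sums are taken over the union.\<close>
  let ?U = "Poly_Mapping.keys c \<union> Poly_Mapping.keys d"
  have U: "finite ?U" "f \<in> ?U \<rightarrow> carrier G" using cd f by auto
  have "formal_sum f (c + d) = (\<Oplus>p\<in>?U. [Poly_Mapping.lookup (c + d) p] \<cdot> f p)"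
    by (rule formal_sum_superset) (use U keys_add[of c d] in auto)
  also have "\<dots> = (\<Oplus>p\<in>?U. [Poly_Mapping.lookup c p] \<cdot> f p \<oplus> [Poly_Mapping.lookup d p] \<cdot> f p)"
    by (rule finsum_cong')
      (use U in \<open>auto simp: Pi_iff Poly_Mapping.lookup_add add.int_pow_mult intro!: add.int_pow_closed\<close>)
  also have "\<dots> = (\<Oplus>p\<in>?U. [Poly_Mapping.lookup c p] \<cdot> f p) \<oplus> (\<Oplus>p\<in>?U. [Poly_Mapping.lookup d p] \<cdot> f p)"
    by (rule finsum_addf) (use U in \<open>auto simp: Pi_iff intro!: add.int_pow_closed\<close>)
  also have "\<dots> = formal_sum f c \<oplus> formal_sum f d"
    using formal_sum_superset[of ?U c f] formal_sum_superset[of ?U d f] U by simp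
  finally show "formal_sum f (c \<otimes>\<^bsub>free_Abelian_group S\<^esub> d) = formal_sum f c \<otimes>\<^bsub>add_monoid G\<^esub> formal_sum f d"
    by simp
qed

lemma formal_sum_frag_of: "f p \<in> carrier G \<Longrightarrow> formal_sum f (frag_of p) = f p"
  using finsum_singleton[of p "{p}" "\<lambda>p. [(1::int)] \<cdot> f p"]
  by (simp add: formal_sum_def add.int_pow_1)

end

definition balanced_map ::
  "('s, 'x) ring_scheme \<Rightarrow> ('r, 'm, 's, 'z) bimodule_scheme \<Rightarrow> ('s, 'n, 't, 'w) bimodule_scheme \<Rightarrow>
    ('c, 'v) ring_scheme \<Rightarrow> ('m \<Rightarrow> 'n \<Rightarrow> 'c) \<Rightarrow> bool" where
  "balanced_map R M N G \<phi> \<longleftrightarrow>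
    (\<forall>x\<in>carrier M. \<forall>y\<in>carrier N. \<phi> x y \<in> carrier G) \<and>
    (\<forall>x\<in>carrier M. \<forall>x'\<in>carrier M. \<forall>y\<in>carrier N. \<phi> (x \<oplus>\<^bsub>M\<^esub> x') y = \<phi> x y \<oplus>\<^bsub>G\<^esub> \<phi> x' y) \<and>
    (\<forall>x\<in>carrier M. \<forall>y\<in>carrier N. \<forall>y'\<in>carrier N. \<phi> x (y \<oplus>\<^bsub>N\<^esub> y') = \<phi> x y \<oplus>\<^bsub>G\<^esub> \<phi> x y') \<and>
    (\<forall>x\<in>carrier M. \<forall>r\<in>carrier R. \<forall>y\<in>carrier N. \<phi> (x \<triangleleft>\<^bsub>M\<^esub> r) y = \<phi> x (r \<odot>\<^bsub>N\<^esub> y))"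

lemma balanced_mapI:
  assumes "\<And>x y. \<lbrakk>x \<in> carrier M; y \<in> carrier N\<rbrakk> \<Longrightarrow> \<phi> x y \<in> carrier G"
    and "\<And>x x' y. \<lbrakk>x \<in> carrier M; x' \<in> carrier M; y \<in> carrier N\<rbrakk> \<Longrightarrow>
      \<phi> (x \<oplus>\<^bsub>M\<^esub> x') y = \<phi> x y \<oplus>\<^bsub>G\<^esub> \<phi> x' y"
    and "\<And>x y y'. \<lbrakk>x \<in> carrier M; y \<in> carrier N; y' \<in> carrier N\<rbrakk> \<Longrightarrow>
      \<phi> x (y \<oplus>\<^bsub>N\<^esub> y') = \<phi> x y \<oplus>\<^bsub>G\<^esub> \<phi> x y'"
    and "\<And>x r y. \<lbrakk>x \<in> carrier M; r \<in> carrier R; y \<in> carrier N\<rbrakk> \<Longrightarrow>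
      \<phi> (x \<triangleleft>\<^bsub>M\<^esub> r) y = \<phi> x (r \<odot>\<^bsub>N\<^esub> y)"
  shows "balanced_map R M N G \<phi>"
  using assms unfolding balanced_map_def by blast

lemma tensor_product_simps:
  "carrier (tensor_product R M N) = carrier (tensor_group R M N)"
  "add (tensor_product R M N) = monoid.mult (tensor_group R M N)"
  "ring.zero (tensor_product R M N) = monoid.one (tensor_group R M N)"
  "l \<odot>\<^bsub>tensor_product R M N\<^esub> X =
    tensor_lift (tensor_ring R M N) (\<lambda>x y. pure_tensor R M N (l \<odot>\<^bsub>M\<^esub> x) y) X"
  "X \<triangleleft>\<^bsub>tensor_product R M N\<^esub> t =
    tensor_lift (tensor_ring R M N) (\<lambda>x y. pure_tensor R M N x (y \<triangleleft>\<^bsub>N\<^esub> t)) X"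
  by (simp_all add: tensor_product_def tensor_ring_def ring.defs)

text \<open>The outer actions are defined by lifting into \<open>tensor_ring\<close>, the bare
  additive group, because the record with actions is still under construction there. These equations
  carry results from one record to the other.\<close>

lemma tensor_ring_simps:
  "carrier (tensor_ring R M N) = carrier (tensor_product R M N)"
  "add (tensor_ring R M N) = add (tensor_product R M N)"
  "ring.zero (tensor_ring R M N) = ring.zero (tensor_product R M N)"
  by (simp_all add: tensor_product_def tensor_ring_def ring.defs)

section \<open>The tensor product as a group of cosets\<close>

locale bimodule_pair = M: bimodule L R M + N: bimodule R T N
  for L :: "('r, 'x) ring_scheme" and R :: "('s, 'y) ring_scheme" and T :: "('t, 'u) ring_scheme"
    and M :: "('r, 'm, 's, 'z) bimodule_scheme" and N :: "('s, 'n, 't, 'w) bimodule_scheme"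
begin

abbreviation F where "F \<equiv> free_Abelian_group (carrier M \<times> carrier N)"
abbreviation K where "K \<equiv> tensor_kernel R M N"
abbreviation MN where "MN \<equiv> tensor_product R M N"
abbreviation pure where "pure \<equiv> pure_tensor R M N"

lemma tensor_relations_subset: "tensor_relations R M N \<subseteq> carrier F"
proof
  fix c assume "c \<in> tensor_relations R M N"
  then obtain p q r where "p \<in> carrier M \<times> carrier N" "q \<in> carrier M \<times> carrier N"
    "r \<in> carrier M \<times> carrier N" "c = frag_of p - frag_of q - frag_of r \<or> c = frag_of p - frag_of q"
    unfolding tensor_relations_def using M.rsmult_closed N.smult_closed
    by (elim UnE CollectE exE conjE) (metis M.M.a_closed N.M.a_closed mem_Sigma_iff)+
  then show "c \<in> carrier F"
    using keys_diff[of "frag_of p" "frag_of q"] keys_diff[of "frag_of p - frag_of q" "frag_of r"]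
    by auto
qed

lemma kernel_subgroup: "subgroup K F"
  unfolding tensor_kernel_def
  by (intro group.generate_is_subgroup tensor_relations_subset group_free_Abelian_group)

lemma kernel_normal: "K \<lhd> F"
  by (intro comm_group.subgroup_imp_normal abelian_free_Abelian_group kernel_subgroup)

lemma abelian_group_tensor: "abelian_group MN"
proof -
  have "comm_group (tensor_group R M N)"
    unfolding tensor_group_def
    by (intro comm_group.abelian_FactGroup abelian_free_Abelian_group kernel_subgroup)
  from comm_groupE[OF this] show ?thesis
    by (intro abelian_groupI) (simp_all only: tensor_product_simps)
qed

sublocale T: abelian_group MN by (rule abelian_group_tensor)

lemma coset_carrier: "carrier MN = (\<lambda>c. K #>\<^bsub>F\<^esub> c) ` carrier F"
  by (simp add: tensor_product_simps tensor_group_def carrier_FactGroup)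

lemma coset_hom: "(\<lambda>c. K #>\<^bsub>F\<^esub> c) \<in> hom F (add_monoid MN)"
  using normal.r_coset_hom_Mod[OF kernel_normal]
  by (simp add: tensor_product_simps tensor_group_def hom_def)

lemma coset_group_hom: "group_hom F (add_monoid MN) (\<lambda>c. K #>\<^bsub>F\<^esub> c)"
  using coset_hom T.a_group by (simp add: group_hom_def group_hom_axioms_def)

text \<open>Stated for differences because induction over a free abelian group builds its elements
  from generators by subtraction.\<close>

lemma coset_diff:
  assumes "c \<in> carrier F" "d \<in> carrier F"
  shows "K #>\<^bsub>F\<^esub> (c - d) = (K #>\<^bsub>F\<^esub> c) \<ominus>\<^bsub>MN\<^esub> (K #>\<^bsub>F\<^esub> d)"
proof -
  interpret h: group_hom F "add_monoid MN" "\<lambda>c. K #>\<^bsub>F\<^esub> c" by (rule coset_group_hom)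
  have "K #>\<^bsub>F\<^esub> (c \<otimes>\<^bsub>F\<^esub> inv\<^bsub>F\<^esub> d) = (K #>\<^bsub>F\<^esub> c) \<oplus>\<^bsub>MN\<^esub> (\<ominus>\<^bsub>MN\<^esub> (K #>\<^bsub>F\<^esub> d))"
    using assms h.hom_mult[OF assms(1), of "inv\<^bsub>F\<^esub> d"] h.hom_inv[OF assms(2)]
      group.inv_closed[OF group_free_Abelian_group assms(2)]
    by (simp add: a_inv_def)
  then show ?thesis using assms by (simp add: a_minus_def)
qed

lemma coset_eqI:
  assumes "c \<in> carrier F" "d \<in> carrier F" "c - d \<in> K"
  shows "K #>\<^bsub>F\<^esub> c = K #>\<^bsub>F\<^esub> d"
proof (rule sym, rule group.repr_independence[OF group_free_Abelian_group _ _ kernel_subgroup])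
  show "c \<in> K #>\<^bsub>F\<^esub> d"
    using assms unfolding r_coset_def by (auto intro!: bexI[of _ "c - d"])
qed (use assms in auto)

lemma pure_closed [simp, intro]:
  "\<lbrakk>x \<in> carrier M; y \<in> carrier N\<rbrakk> \<Longrightarrow> pure x y \<in> carrier MN"
  unfolding coset_carrier pure_tensor_def by (rule imageI) simp

lemma relations_kernel:
  "\<lbrakk>x \<in> carrier M; x' \<in> carrier M; y \<in> carrier N\<rbrakk> \<Longrightarrow>
    frag_of (x \<oplus>\<^bsub>M\<^esub> x', y) - frag_of (x, y) - frag_of (x', y) \<in> K"
  "\<lbrakk>x \<in> carrier M; y \<in> carrier N; y' \<in> carrier N\<rbrakk> \<Longrightarrow>
    frag_of (x, y \<oplus>\<^bsub>N\<^esub> y') - frag_of (x, y) - frag_of (x, y') \<in> K"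
  "\<lbrakk>x \<in> carrier M; r \<in> carrier R; y \<in> carrier N\<rbrakk> \<Longrightarrow>
    frag_of (x \<triangleleft>\<^bsub>M\<^esub> r, y) - frag_of (x, r \<odot>\<^bsub>N\<^esub> y) \<in> K"
  unfolding tensor_kernel_def tensor_relations_def by (rule generate.incl, blast)+

lemma pure_sum:
  assumes "x \<in> carrier M" "y \<in> carrier N" "x' \<in> carrier M" "y' \<in> carrier N"
  shows "K #>\<^bsub>F\<^esub> (frag_of (x, y) + frag_of (x', y')) = pure x y \<oplus>\<^bsub>MN\<^esub> pure x' y'"
  using hom_mult[OF coset_hom, of "frag_of (x, y)" "frag_of (x', y')"] assms
  by (simp add: pure_tensor_def)

lemma frag_sum_carrier:
  assumes "p \<in> carrier M \<times> carrier N" "q \<in> carrier M \<times> carrier N"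
  shows "frag_of p + frag_of q \<in> carrier F" "frag_of p - frag_of q \<in> carrier F"
  using assms keys_add[of "frag_of p" "frag_of q"] keys_diff[of "frag_of p" "frag_of q"] by auto

lemma pure_add_left:
  assumes "x \<in> carrier M" "x' \<in> carrier M" "y \<in> carrier N"
  shows "pure (x \<oplus>\<^bsub>M\<^esub> x') y = pure x y \<oplus>\<^bsub>MN\<^esub> pure x' y"
  unfolding pure_sum[OF assms(1,3,2,3), symmetric] unfolding pure_tensor_def
proof (rule coset_eqI)
  show "frag_of (x \<oplus>\<^bsub>M\<^esub> x', y) - (frag_of (x, y) + frag_of (x', y)) \<in> K"
    using relations_kernel(1)[OF assms] by (simp only: diff_diff_eq)
qed (use assms in \<open>auto intro!: frag_sum_carrier simp del: carrier_free_Abelian_group_iff\<close>)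

lemma pure_add_right:
  assumes "x \<in> carrier M" "y \<in> carrier N" "y' \<in> carrier N"
  shows "pure x (y \<oplus>\<^bsub>N\<^esub> y') = pure x y \<oplus>\<^bsub>MN\<^esub> pure x y'"
  unfolding pure_sum[OF assms(1,2,1,3), symmetric] unfolding pure_tensor_def
proof (rule coset_eqI)
  show "frag_of (x, y \<oplus>\<^bsub>N\<^esub> y') - (frag_of (x, y) + frag_of (x, y')) \<in> K"
    using relations_kernel(2)[OF assms] by (simp only: diff_diff_eq)
qed (use assms in \<open>auto intro!: frag_sum_carrier simp del: carrier_free_Abelian_group_iff\<close>)

lemma pure_balanced:
  assumes "x \<in> carrier M" "r \<in> carrier R" "y \<in> carrier N"
  shows "pure (x \<triangleleft>\<^bsub>M\<^esub> r) y = pure x (r \<odot>\<^bsub>N\<^esub> y)"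
  unfolding pure_tensor_def
  by (rule coset_eqI) (use assms relations_kernel(3) M.rsmult_closed N.smult_closed in auto)

lemma pure_zero_left: "y \<in> carrier N \<Longrightarrow> pure \<zero>\<^bsub>M\<^esub> y = \<zero>\<^bsub>MN\<^esub>"
  using pure_add_left[of "\<zero>\<^bsub>M\<^esub>" "\<zero>\<^bsub>M\<^esub>" y] T.add.l_cancel_one'[of "pure \<zero>\<^bsub>M\<^esub> y" "pure \<zero>\<^bsub>M\<^esub> y"]
  by simp

text \<open>A sign can be absorbed into the left factor, so an integer combination of pure tensors
  is a plain sum of pure tensors.\<close>

lemma pure_neg: "\<lbrakk>x \<in> carrier M; y \<in> carrier N\<rbrakk> \<Longrightarrow> \<ominus>\<^bsub>MN\<^esub> (pure x y) = pure (\<ominus>\<^bsub>M\<^esub> x) y"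
  by (rule T.minus_equality)
    (simp_all add: pure_add_left[symmetric] pure_zero_left M.M.l_neg)

text \<open>Zero is the pure tensor of two zeros and the negative of a pure tensor is pure, so sums
  of pure tensors already exhaust the group and two cases suffice.\<close>

lemma tensor_induct [consumes 1, case_names pure add]:
  assumes X: "X \<in> carrier MN"
    and p: "\<And>x y. \<lbrakk>x \<in> carrier M; y \<in> carrier N\<rbrakk> \<Longrightarrow> P (pure x y)"
    and a: "\<And>X Y. \<lbrakk>X \<in> carrier MN; Y \<in> carrier MN; P X; P Y\<rbrakk> \<Longrightarrow> P (X \<oplus>\<^bsub>MN\<^esub> Y)"
  shows "P X"
proof -
  obtain c where c: "c \<in> carrier F" "X = K #>\<^bsub>F\<^esub> c" using X unfolding coset_carrier by blast
  have minus_zero: "\<ominus>\<^bsub>MN\<^esub> \<zero>\<^bsub>MN\<^esub> = \<zero>\<^bsub>MN\<^esub>"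
    by (rule T.minus_equality) simp_all
  have z: "P \<zero>\<^bsub>MN\<^esub>" using p[of "\<zero>\<^bsub>M\<^esub>" "\<zero>\<^bsub>N\<^esub>"] by (simp add: pure_zero_left)
  \<comment> \<open>The induction over the free abelian group passes to differences while P is only
    known to be closed under sums, hence the claim for the negative coset is carried along.\<close>
  have "P (K #>\<^bsub>F\<^esub> c) \<and> P (\<ominus>\<^bsub>MN\<^esub> (K #>\<^bsub>F\<^esub> c))"
  proof (rule free_Abelian_group_induct[of c "carrier M \<times> carrier N"])
    show "Poly_Mapping.keys c \<subseteq> carrier M \<times> carrier N" using c by simp
    have "K #>\<^bsub>F\<^esub> 0 = \<zero>\<^bsub>MN\<^esub>"
      using group_hom.hom_one[OF coset_group_hom] by simp
    then show "P (K #>\<^bsub>F\<^esub> 0) \<and> P (\<ominus>\<^bsub>MN\<^esub> (K #>\<^bsub>F\<^esub> 0))" using z by (simp add: minus_zero)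
  next
    fix d e :: "'m \<times> 'n \<Rightarrow>\<^sub>0 int"
    assume de: "Poly_Mapping.keys d \<subseteq> carrier M \<times> carrier N"
      "Poly_Mapping.keys e \<subseteq> carrier M \<times> carrier N"
      and "P (K #>\<^bsub>F\<^esub> d) \<and> P (\<ominus>\<^bsub>MN\<^esub> (K #>\<^bsub>F\<^esub> d))" "P (K #>\<^bsub>F\<^esub> e) \<and> P (\<ominus>\<^bsub>MN\<^esub> (K #>\<^bsub>F\<^esub> e))"
    moreover have "K #>\<^bsub>F\<^esub> d \<in> carrier MN" "K #>\<^bsub>F\<^esub> e \<in> carrier MN"
      using de by (auto simp: coset_carrier)
    ultimately show "P (K #>\<^bsub>F\<^esub> (d - e)) \<and> P (\<ominus>\<^bsub>MN\<^esub> (K #>\<^bsub>F\<^esub> (d - e)))"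
      by (auto simp: coset_diff a_minus_def T.minus_add intro!: a)
  next
    fix q assume "q \<in> carrier M \<times> carrier N"
    then obtain x y where q: "q = (x, y)" "x \<in> carrier M" "y \<in> carrier N" by auto
    then have "P (pure x y)" "P (\<ominus>\<^bsub>MN\<^esub> (pure x y))"
      using p by (auto simp: pure_neg)
    then show "P (K #>\<^bsub>F\<^esub> frag_of q) \<and> P (\<ominus>\<^bsub>MN\<^esub> (K #>\<^bsub>F\<^esub> frag_of q))"
      by (simp add: q pure_tensor_def)
  qed
  then show ?thesis using c by simp
qed

section \<open>Universal property of the tensor product\<close>

context
  fixes G :: "('c, 'v) ring_scheme" and \<phi> :: "'m \<Rightarrow> 'n \<Rightarrow> 'c"
  assumes G: "abelian_group G" and \<phi>: "balanced_map R M N G \<phi>"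
begin

interpretation G: abelian_group G by (rule G)

private abbreviation ev where "ev \<equiv> G.formal_sum (\<lambda>p. \<phi> (fst p) (snd p))"

private lemma ev_group_hom: "group_hom F (add_monoid G) ev"
proof -
  have "(\<lambda>p. \<phi> (fst p) (snd p)) \<in> carrier M \<times> carrier N \<rightarrow> carrier G"
    using \<phi> unfolding balanced_map_def by auto
  from G.formal_sum_hom[OF this] show ?thesis
    using G.a_group by (simp add: group_hom_def group_hom_axioms_def)
qed

interpretation ev: group_hom F "add_monoid G" ev by (rule ev_group_hom)

private lemma ev_diff: "\<lbrakk>c \<in> carrier F; d \<in> carrier F\<rbrakk> \<Longrightarrow> ev (c - d) = ev c \<ominus>\<^bsub>G\<^esub> ev d"
  using ev.hom_mult[of c "inv\<^bsub>F\<^esub> d"] ev.hom_inv[of d] group.inv_closed[OF group_free_Abelian_group, of d]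
  by (simp add: a_inv_def a_minus_def)

private lemma ev_frag: "\<lbrakk>x \<in> carrier M; y \<in> carrier N\<rbrakk> \<Longrightarrow> ev (frag_of (x, y)) = \<phi> x y"
  using \<phi> by (subst G.formal_sum_frag_of) (auto simp: balanced_map_def)

text \<open>The kernel of a homomorphism is a subgroup, so it contains the subgroup generated by the
  relations once it contains the relations. Each of the three kinds of relation is killed by one
  clause of \<open>balanced_map\<close>.\<close>

private lemma ev_kernel: "c \<in> K \<Longrightarrow> ev c = \<zero>\<^bsub>G\<^esub>"
proof -
  have "K \<subseteq> kernel F (add_monoid G) ev"
    unfolding tensor_kernel_def
  proof (rule group.generate_subgroup_incl[OF group_free_Abelian_group _ ev.subgroup_kernel], rule subsetI)
    fix c assume c: "c \<in> tensor_relations R M N"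
    have cl [simp]: "\<phi> x y \<in> carrier G" if "x \<in> carrier M" "y \<in> carrier N" for x y
      using \<phi> that unfolding balanced_map_def by blast
    have d2: "ev (frag_of (x, y) - frag_of (x', y')) = \<phi> x y \<ominus>\<^bsub>G\<^esub> \<phi> x' y'"
      if "x \<in> carrier M" "y \<in> carrier N" "x' \<in> carrier M" "y' \<in> carrier N" for x y x' y'
      using that ev_diff[of "frag_of (x, y)" "frag_of (x', y')"] by (simp add: ev_frag)
    have d3: "ev (frag_of (x, y) - frag_of (x', y') - frag_of (x'', y'')) =
        \<phi> x y \<ominus>\<^bsub>G\<^esub> \<phi> x' y' \<ominus>\<^bsub>G\<^esub> \<phi> x'' y''"
      if "x \<in> carrier M" "y \<in> carrier N" "x' \<in> carrier M" "y' \<in> carrier N"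
        "x'' \<in> carrier M" "y'' \<in> carrier N" for x y x' y' x'' y''
      using that ev_diff[of "frag_of (x, y) - frag_of (x', y')" "frag_of (x'', y'')"]
        frag_sum_carrier(2)[of "(x, y)" "(x', y')"]
      by (simp add: ev_frag d2)
    have cancel: "a \<oplus>\<^bsub>G\<^esub> b \<ominus>\<^bsub>G\<^esub> a \<ominus>\<^bsub>G\<^esub> b = \<zero>\<^bsub>G\<^esub>" "a \<ominus>\<^bsub>G\<^esub> a = \<zero>\<^bsub>G\<^esub>"
      if "a \<in> carrier G" "b \<in> carrier G" for a b
    proof -
      have "a \<oplus>\<^bsub>G\<^esub> b \<ominus>\<^bsub>G\<^esub> a \<ominus>\<^bsub>G\<^esub> b = (a \<oplus>\<^bsub>G\<^esub> b) \<oplus>\<^bsub>G\<^esub> (\<ominus>\<^bsub>G\<^esub> a \<oplus>\<^bsub>G\<^esub> \<ominus>\<^bsub>G\<^esub> b)"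
        using that unfolding a_minus_def by (intro G.a_assoc) simp_all
      also have "\<dots> = \<zero>\<^bsub>G\<^esub>"
        using that G.r_neg[of "a \<oplus>\<^bsub>G\<^esub> b"] unfolding G.minus_add[OF that] by simp
      finally show "a \<oplus>\<^bsub>G\<^esub> b \<ominus>\<^bsub>G\<^esub> a \<ominus>\<^bsub>G\<^esub> b = \<zero>\<^bsub>G\<^esub>" .
      show "a \<ominus>\<^bsub>G\<^esub> a = \<zero>\<^bsub>G\<^esub>" using that by (simp add: a_minus_def G.r_neg)
    qed
    have "ev c = \<zero>\<^bsub>G\<^esub>"
      using c unfolding tensor_relations_def
    proof (elim UnE CollectE exE conjE)
      fix x x' y
      assume c: "c = frag_of (x \<oplus>\<^bsub>M\<^esub> x', y) - frag_of (x, y) - frag_of (x', y)"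
        and xy: "x \<in> carrier M" "x' \<in> carrier M" "y \<in> carrier N"
      then have "\<phi> (x \<oplus>\<^bsub>M\<^esub> x') y = \<phi> x y \<oplus>\<^bsub>G\<^esub> \<phi> x' y"
        using \<phi> unfolding balanced_map_def by blast
      with xy show ?thesis unfolding c by (subst d3) (simp_all add: cancel)
    next
      fix x y y'
      assume c: "c = frag_of (x, y \<oplus>\<^bsub>N\<^esub> y') - frag_of (x, y) - frag_of (x, y')"
        and xy: "x \<in> carrier M" "y \<in> carrier N" "y' \<in> carrier N"
      then have "\<phi> x (y \<oplus>\<^bsub>N\<^esub> y') = \<phi> x y \<oplus>\<^bsub>G\<^esub> \<phi> x y'"
        using \<phi> unfolding balanced_map_def by blast
      with xy show ?thesis unfolding c by (subst d3) (simp_all add: cancel)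
    next
      fix x r y
      assume c: "c = frag_of (x \<triangleleft>\<^bsub>M\<^esub> r, y) - frag_of (x, r \<odot>\<^bsub>N\<^esub> y)"
        and xy: "x \<in> carrier M" "r \<in> carrier R" "y \<in> carrier N"
      then have "\<phi> (x \<triangleleft>\<^bsub>M\<^esub> r) y = \<phi> x (r \<odot>\<^bsub>N\<^esub> y)"
        using \<phi> unfolding balanced_map_def by blast
      \<comment> \<open>Both parts of \<open>cancel\<close> share the premise that b lies in the
        carrier, so the second part is instantiated with zero for b.\<close>
      with xy show ?thesis
        unfolding c by (subst d2) (simp_all add: cancel(2)[of _ "\<zero>\<^bsub>G\<^esub>"] M.rsmult_closed N.smult_closed)
    qed
    then show "c \<in> kernel F (add_monoid G) ev"
      using subsetD[OF tensor_relations_subset c] by (simp add: kernel_def)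
  qed
  then show "c \<in> K \<Longrightarrow> ev c = \<zero>\<^bsub>G\<^esub>" by (auto simp: kernel_def)
qed

text \<open>Since \<open>ev\<close> vanishes on the kernel it is constant on each coset. Its image
  there is a singleton, so \<open>the_elem\<close> in \<open>tensor_lift\<close> returns the common
  value.\<close>

private lemma lift_coset:
  assumes c: "c \<in> carrier F" shows "tensor_lift G \<phi> (K #>\<^bsub>F\<^esub> c) = ev c"
proof -
  have ev_c: "ev (k + c) = ev c" if "k \<in> K" for k
    using that c ev.hom_mult[of k c] subgroup.mem_carrier[OF kernel_subgroup that]
      ev.hom_closed[OF c] ev_kernel[OF that] by simp
  have "K #>\<^bsub>F\<^esub> c = (\<lambda>k. k + c) ` K" unfolding r_coset_def by auto
  then have "ev ` (K #>\<^bsub>F\<^esub> c) = (\<lambda>k. ev c) ` K"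
    by (simp add: image_image ev_c cong: image_cong_simp)
  also have "\<dots> = {ev c}" using subgroup.one_closed[OF kernel_subgroup] by blast
  finally have "ev ` (K #>\<^bsub>F\<^esub> c) = {ev c}" .
  then show ?thesis
    unfolding tensor_lift_def G.formal_sum_def[abs_def] by simp
qed

lemma tensor_lift_closed: "X \<in> carrier MN \<Longrightarrow> tensor_lift G \<phi> X \<in> carrier G"
  using ev.hom_closed unfolding coset_carrier by (auto simp: lift_coset)

lemma tensor_lift_pure:
  "\<lbrakk>x \<in> carrier M; y \<in> carrier N\<rbrakk> \<Longrightarrow> tensor_lift G \<phi> (pure x y) = \<phi> x y"
  by (simp add: pure_tensor_def lift_coset ev_frag)

lemma tensor_lift_add:
  assumes "X \<in> carrier MN" "Y \<in> carrier MN"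
  shows "tensor_lift G \<phi> (X \<oplus>\<^bsub>MN\<^esub> Y) = tensor_lift G \<phi> X \<oplus>\<^bsub>G\<^esub> tensor_lift G \<phi> Y"
proof -
  obtain c d where cd: "c \<in> carrier F" "X = K #>\<^bsub>F\<^esub> c" "d \<in> carrier F" "Y = K #>\<^bsub>F\<^esub> d"
    using assms unfolding coset_carrier by blast
  have "X \<oplus>\<^bsub>MN\<^esub> Y = K #>\<^bsub>F\<^esub> (c \<otimes>\<^bsub>F\<^esub> d)"
    using hom_mult[OF coset_hom cd(1,3)] cd by simp
  moreover have "c \<otimes>\<^bsub>F\<^esub> d \<in> carrier F"
    using cd by (intro monoid.m_closed group.is_monoid group_free_Abelian_group)
  ultimately show ?thesis
    using cd ev.hom_mult[OF cd(1,3)] by (simp only: lift_coset) simp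
qed

end

lemma tensor_hom_eqI:
  assumes "\<And>x y. \<lbrakk>x \<in> carrier M; y \<in> carrier N\<rbrakk> \<Longrightarrow> f (pure x y) = g (pure x y)"
    and "\<And>X Y. \<lbrakk>X \<in> carrier MN; Y \<in> carrier MN\<rbrakk> \<Longrightarrow> f (X \<oplus>\<^bsub>MN\<^esub> Y) = f X \<oplus>\<^bsub>G\<^esub> f Y"
    and "\<And>X Y. \<lbrakk>X \<in> carrier MN; Y \<in> carrier MN\<rbrakk> \<Longrightarrow> g (X \<oplus>\<^bsub>MN\<^esub> Y) = g X \<oplus>\<^bsub>G\<^esub> g Y"
    and "X \<in> carrier MN"
  shows "f X = g X"
  using assms(4) by (induction rule: tensor_induct) (simp_all add: assms(1-3))

section \<open>The outer bimodule structure\<close>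

lemma abelian_group_tensor_ring: "abelian_group (tensor_ring R M N)"
  using abelian_groupE[OF abelian_group_tensor] by (intro abelian_groupI) (simp_all only: tensor_ring_simps)

text \<open>Compatibility with the inner ring R comes from the fact that the left and right actions
  on M commute.\<close>

lemma smult_balanced:
  "l \<in> carrier L \<Longrightarrow> balanced_map R M N (tensor_ring R M N) (\<lambda>x y. pure (l \<odot>\<^bsub>M\<^esub> x) y)"
  by (rule balanced_mapI) (auto simp: tensor_ring_simps M.smult_closed M.smult_r_distr M.smult_rsmult
      pure_add_left pure_add_right pure_balanced[symmetric])

lemma rsmult_balanced:
  "t \<in> carrier T \<Longrightarrow> balanced_map R M N (tensor_ring R M N) (\<lambda>x y. pure x (y \<triangleleft>\<^bsub>N\<^esub> t))"
  by (rule balanced_mapI) (auto simp: tensor_ring_simps N.rsmult_closed N.rsmult_l_distr N.smult_rsmult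
      pure_add_left pure_add_right pure_balanced)

lemma smult_pure:
  "\<lbrakk>l \<in> carrier L; x \<in> carrier M; y \<in> carrier N\<rbrakk> \<Longrightarrow> l \<odot>\<^bsub>MN\<^esub> pure x y = pure (l \<odot>\<^bsub>M\<^esub> x) y"
  unfolding tensor_product_simps(4)
  by (rule tensor_lift_pure[OF abelian_group_tensor_ring smult_balanced])

lemma rsmult_pure:
  "\<lbrakk>t \<in> carrier T; x \<in> carrier M; y \<in> carrier N\<rbrakk> \<Longrightarrow> pure x y \<triangleleft>\<^bsub>MN\<^esub> t = pure x (y \<triangleleft>\<^bsub>N\<^esub> t)"
  unfolding tensor_product_simps(5)
  by (rule tensor_lift_pure[OF abelian_group_tensor_ring rsmult_balanced])

lemma tensor_smult_closed:
  "\<lbrakk>l \<in> carrier L; X \<in> carrier MN\<rbrakk> \<Longrightarrow> l \<odot>\<^bsub>MN\<^esub> X \<in> carrier MN"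
  using tensor_lift_closed[OF abelian_group_tensor_ring smult_balanced]
  unfolding tensor_product_simps(4) tensor_ring_simps .

lemma tensor_rsmult_closed:
  "\<lbrakk>t \<in> carrier T; X \<in> carrier MN\<rbrakk> \<Longrightarrow> X \<triangleleft>\<^bsub>MN\<^esub> t \<in> carrier MN"
  using tensor_lift_closed[OF abelian_group_tensor_ring rsmult_balanced]
  unfolding tensor_product_simps(5) tensor_ring_simps .

lemma tensor_smult_add:
  "\<lbrakk>l \<in> carrier L; X \<in> carrier MN; Y \<in> carrier MN\<rbrakk> \<Longrightarrow>
    l \<odot>\<^bsub>MN\<^esub> (X \<oplus>\<^bsub>MN\<^esub> Y) = l \<odot>\<^bsub>MN\<^esub> X \<oplus>\<^bsub>MN\<^esub> l \<odot>\<^bsub>MN\<^esub> Y"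
  using tensor_lift_add[OF abelian_group_tensor_ring smult_balanced]
  unfolding tensor_product_simps(4) tensor_ring_simps .

lemma tensor_rsmult_add:
  "\<lbrakk>t \<in> carrier T; X \<in> carrier MN; Y \<in> carrier MN\<rbrakk> \<Longrightarrow>
    (X \<oplus>\<^bsub>MN\<^esub> Y) \<triangleleft>\<^bsub>MN\<^esub> t = (X \<triangleleft>\<^bsub>MN\<^esub> t) \<oplus>\<^bsub>MN\<^esub> (Y \<triangleleft>\<^bsub>MN\<^esub> t)"
  using tensor_lift_add[OF abelian_group_tensor_ring rsmult_balanced]
  unfolding tensor_product_simps(5) tensor_ring_simps .

text \<open>Closure and additivity in the tensor come from the lifts. The remaining laws compare
  additive functions of the tensor, so they are checked on pure tensors, where they are laws of the
  outer factors.\<close>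

lemma bimodule_tensor: "bimodule L T MN"
proof (intro bimodule.intro bimodule_axioms.intro)
  fix a b X assume "a \<in> carrier L" "b \<in> carrier L" "X \<in> carrier MN"
  note ab = this(1,2)
  show "(a \<oplus>\<^bsub>L\<^esub> b) \<odot>\<^bsub>MN\<^esub> X = a \<odot>\<^bsub>MN\<^esub> X \<oplus>\<^bsub>MN\<^esub> b \<odot>\<^bsub>MN\<^esub> X"
    using \<open>X \<in> carrier MN\<close>
    by (induction rule: tensor_induct) (use ab in \<open>simp_all add: smult_pure M.smult_closed
        M.smult_l_distr pure_add_left tensor_smult_add tensor_smult_closed T.a_ac\<close>)
  show "(a \<otimes>\<^bsub>L\<^esub> b) \<odot>\<^bsub>MN\<^esub> X = a \<odot>\<^bsub>MN\<^esub> (b \<odot>\<^bsub>MN\<^esub> X)"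
    using \<open>X \<in> carrier MN\<close>
    by (induction rule: tensor_induct) (use ab in \<open>simp_all add: smult_pure M.smult_closed
        M.smult_assoc tensor_smult_add tensor_smult_closed\<close>)
next
  fix X assume "X \<in> carrier MN"
  then show "\<one>\<^bsub>L\<^esub> \<odot>\<^bsub>MN\<^esub> X = X"
    by (induction rule: tensor_induct) (simp_all add: smult_pure M.smult_one tensor_smult_add)
  show "X \<triangleleft>\<^bsub>MN\<^esub> \<one>\<^bsub>T\<^esub> = X"
    using \<open>X \<in> carrier MN\<close>
    by (induction rule: tensor_induct) (simp_all add: rsmult_pure N.rsmult_one tensor_rsmult_add)
next
  fix X a b assume "X \<in> carrier MN" "a \<in> carrier T" "b \<in> carrier T"
  note ab = this(2,3)
  show "X \<triangleleft>\<^bsub>MN\<^esub> (a \<oplus>\<^bsub>T\<^esub> b) = (X \<triangleleft>\<^bsub>MN\<^esub> a) \<oplus>\<^bsub>MN\<^esub> (X \<triangleleft>\<^bsub>MN\<^esub> b)"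
    using \<open>X \<in> carrier MN\<close>
    by (induction rule: tensor_induct) (use ab in \<open>simp_all add: rsmult_pure N.rsmult_closed
        N.rsmult_r_distr pure_add_right tensor_rsmult_add tensor_rsmult_closed T.a_ac\<close>)
  show "X \<triangleleft>\<^bsub>MN\<^esub> (a \<otimes>\<^bsub>T\<^esub> b) = (X \<triangleleft>\<^bsub>MN\<^esub> a) \<triangleleft>\<^bsub>MN\<^esub> b"
    using \<open>X \<in> carrier MN\<close>
    by (induction rule: tensor_induct) (use ab in \<open>simp_all add: rsmult_pure N.rsmult_closed
        N.rsmult_assoc tensor_rsmult_add tensor_rsmult_closed\<close>)
next
  fix a X b assume "a \<in> carrier L" "X \<in> carrier MN" "b \<in> carrier T"
  note ab = this(1,3)
  show "(a \<odot>\<^bsub>MN\<^esub> X) \<triangleleft>\<^bsub>MN\<^esub> b = a \<odot>\<^bsub>MN\<^esub> (X \<triangleleft>\<^bsub>MN\<^esub> b)"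
    using \<open>X \<in> carrier MN\<close>
    by (induction rule: tensor_induct) (use ab in \<open>simp_all add: smult_pure rsmult_pure M.smult_closed
        N.rsmult_closed tensor_smult_add tensor_rsmult_add tensor_smult_closed tensor_rsmult_closed\<close>)
qed (simp_all add: M.L.ring_axioms N.R.ring_axioms abelian_group_tensor tensor_smult_closed tensor_rsmult_closed
    tensor_smult_add tensor_rsmult_add)

end


section \<open>Direct summands\<close>

lemma ring_carrier_update [simp]: "A\<lparr>carrier := carrier A\<rparr> = A" for A :: "('a, 'x) ring_scheme"
  by (cases A) simp

lemma regular_bimodule_simps [simp]:
  "carrier (regular_bimodule A) = carrier A"
  "add (regular_bimodule A) = add A"
  "ring.zero (regular_bimodule A) = ring.zero A"
  "smult (regular_bimodule A) = monoid.mult A"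
  "rsmult (regular_bimodule A) = monoid.mult A"
  by (simp_all add: regular_bimodule_def)

text \<open>Two separate subrings act because the tensor square is formed from A as an A-B-bimodule
  and A as a B-A-bimodule.\<close>

lemma (in ring) bimodule_regular:
  assumes "subring B R" "subring C R"
  shows "bimodule (R\<lparr>carrier := B\<rparr>) (R\<lparr>carrier := C\<rparr>) (regular_bimodule R)"
proof -
  have [simp]: "a \<in> carrier R" if "a \<in> B \<or> a \<in> C" for a
    using that subringE(1)[OF assms(1)] subringE(1)[OF assms(2)] by auto
  have "abelian_group (regular_bimodule R)"
    using abelian_groupE[OF is_abelian_group] by (intro abelian_groupI) simp_all
  then show ?thesis
    by (intro bimodule.intro bimodule_axioms.intro subring_is_ring assms)
      (simp_all add: l_distr r_distr m_assoc)
qed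

lemma direct_power_simps [simp]:
  "carrier (direct_power n M) = {..<n} \<rightarrow>\<^sub>E carrier M"
  "ring.zero (direct_power n M) = (\<lambda>i\<in>{..<n}. \<zero>\<^bsub>M\<^esub>)"
  "add (direct_power n M) = (\<lambda>x y. \<lambda>i\<in>{..<n}. x i \<oplus>\<^bsub>M\<^esub> y i)"
  "smult (direct_power n M) = (\<lambda>a x. \<lambda>i\<in>{..<n}. a \<odot>\<^bsub>M\<^esub> x i)"
  "rsmult (direct_power n M) = (\<lambda>x a. \<lambda>i\<in>{..<n}. x i \<triangleleft>\<^bsub>M\<^esub> a)"
  by (simp_all add: direct_power_def)

lemma (in bimodule) bimodule_direct_power: "bimodule L R (direct_power n M)"
proof -
  have "abelian_group (direct_power n M)"
  proof (rule abelian_groupI)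
    fix x assume x: "x \<in> carrier (direct_power n M)"
    show "\<exists>y\<in>carrier (direct_power n M). y \<oplus>\<^bsub>direct_power n M\<^esub> x = \<zero>\<^bsub>direct_power n M\<^esub>"
      by (rule bexI[of _ "\<lambda>i\<in>{..<n}. \<ominus>\<^bsub>M\<^esub> x i"]) (use x in \<open>auto simp: PiE_iff M.l_neg\<close>)
    show "\<zero>\<^bsub>direct_power n M\<^esub> \<oplus>\<^bsub>direct_power n M\<^esub> x = x"
      using x by (auto simp: PiE_iff extensional_def fun_eq_iff)
  qed (auto simp: PiE_iff M.a_ac)
  then show ?thesis
    by (intro bimodule.intro bimodule_axioms.intro)
      (auto simp: PiE_iff smult_closed smult_l_distr smult_r_distr smult_assoc smult_one
        rsmult_closed rsmult_l_distr rsmult_r_distr rsmult_assoc rsmult_one smult_rsmult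
        L.ring_axioms R.ring_axioms extensional_def fun_eq_iff)
qed

lemma bimodule_homD:
  assumes "f \<in> bimodule_hom L R M N"
  shows "x \<in> carrier M \<Longrightarrow> f x \<in> carrier N"
    "\<lbrakk>x \<in> carrier M; y \<in> carrier M\<rbrakk> \<Longrightarrow> f (x \<oplus>\<^bsub>M\<^esub> y) = f x \<oplus>\<^bsub>N\<^esub> f y"
    "\<lbrakk>a \<in> carrier L; x \<in> carrier M\<rbrakk> \<Longrightarrow> f (a \<odot>\<^bsub>M\<^esub> x) = a \<odot>\<^bsub>N\<^esub> f x"
    "\<lbrakk>x \<in> carrier M; b \<in> carrier R\<rbrakk> \<Longrightarrow> f (x \<triangleleft>\<^bsub>M\<^esub> b) = f x \<triangleleft>\<^bsub>N\<^esub> b"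
  using assms unfolding bimodule_hom_def by auto

lemma bimodule_homI:
  assumes "\<And>x. x \<in> carrier M \<Longrightarrow> f x \<in> carrier N"
    "\<And>x y. \<lbrakk>x \<in> carrier M; y \<in> carrier M\<rbrakk> \<Longrightarrow> f (x \<oplus>\<^bsub>M\<^esub> y) = f x \<oplus>\<^bsub>N\<^esub> f y"
    "\<And>a x. \<lbrakk>a \<in> carrier L; x \<in> carrier M\<rbrakk> \<Longrightarrow> f (a \<odot>\<^bsub>M\<^esub> x) = a \<odot>\<^bsub>N\<^esub> f x"
    "\<And>x b. \<lbrakk>x \<in> carrier M; b \<in> carrier R\<rbrakk> \<Longrightarrow> f (x \<triangleleft>\<^bsub>M\<^esub> b) = f x \<triangleleft>\<^bsub>N\<^esub> b"
  shows "f \<in> bimodule_hom L R M N"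
  using assms unfolding bimodule_hom_def by auto

lemma subbimoduleD:
  assumes "subbimodule L R P M" "abelian_group M"
  shows "P \<subseteq> carrier M" "\<zero>\<^bsub>M\<^esub> \<in> P" "x \<in> P \<Longrightarrow> \<ominus>\<^bsub>M\<^esub> x \<in> P"
    "\<lbrakk>x \<in> P; y \<in> P\<rbrakk> \<Longrightarrow> x \<oplus>\<^bsub>M\<^esub> y \<in> P"
    "\<lbrakk>a \<in> carrier L; x \<in> P\<rbrakk> \<Longrightarrow> a \<odot>\<^bsub>M\<^esub> x \<in> P"
    "\<lbrakk>x \<in> P; b \<in> carrier R\<rbrakk> \<Longrightarrow> x \<triangleleft>\<^bsub>M\<^esub> b \<in> P"
proof -
  interpret additive_subgroup P M using assms(1) by (simp add: subbimodule_def)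
  interpret abelian_group M by (rule assms(2))
  show "P \<subseteq> carrier M" "\<zero>\<^bsub>M\<^esub> \<in> P" "x \<in> P \<Longrightarrow> \<ominus>\<^bsub>M\<^esub> x \<in> P"
    "\<lbrakk>x \<in> P; y \<in> P\<rbrakk> \<Longrightarrow> x \<oplus>\<^bsub>M\<^esub> y \<in> P"
    using a_subset zero_closed a_subgroup subgroup.m_inv_closed[OF a_subgroup] a_closed
    by (auto simp: a_inv_def)
  show "\<lbrakk>a \<in> carrier L; x \<in> P\<rbrakk> \<Longrightarrow> a \<odot>\<^bsub>M\<^esub> x \<in> P" "\<lbrakk>x \<in> P; b \<in> carrier R\<rbrakk> \<Longrightarrow> x \<triangleleft>\<^bsub>M\<^esub> b \<in> P"
    using assms(1) by (auto simp: subbimodule_def)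
qed

text \<open>A trivial intersection makes the decomposition into a P-part and a Q-part unique. Taking
  the P-part then respects sums and actions because both summands are closed under them.\<close>

lemma (in bimodule) direct_summand_projection:
  assumes "direct_summand L R P M"
  obtains p where "p \<in> bimodule_hom L R M (M\<lparr>carrier := P\<rparr>)" "\<And>x. x \<in> P \<Longrightarrow> p x = x"
proof -
  obtain Q where P: "subbimodule L R P M" and Q: "subbimodule L R Q M"
    and int: "P \<inter> Q = {\<zero>\<^bsub>M\<^esub>}" and sum: "P <+>\<^bsub>M\<^esub> Q = carrier M"
    using assms unfolding direct_summand_def by blast
  note P = subbimoduleD[OF P M.abelian_group_axioms] and Q = subbimoduleD[OF Q M.abelian_group_axioms]
  have ex: "\<exists>x\<in>P. \<exists>y\<in>Q. z = x \<oplus>\<^bsub>M\<^esub> y" if "z \<in> carrier M" for z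
  proof -
    have "z \<in> P <+>\<^bsub>M\<^esub> Q" using that sum by simp
    then show ?thesis by (auto simp: set_add_def set_mult_def)
  qed
  have uniq: "x = x'" if "x \<in> P" "y \<in> Q" "x' \<in> P" "y' \<in> Q" "x \<oplus>\<^bsub>M\<^esub> y = x' \<oplus>\<^bsub>M\<^esub> y'" for x y x' y'
  proof -
    have c: "x \<in> carrier M" "y \<in> carrier M" "x' \<in> carrier M" "y' \<in> carrier M"
      using that P(1) Q(1) by auto
    \<comment> \<open>The difference of the P-parts equals the reversed difference of the Q-parts,
      so it lies in both P and Q.\<close>
    have "x \<ominus>\<^bsub>M\<^esub> x' = (\<ominus>\<^bsub>M\<^esub> x' \<oplus>\<^bsub>M\<^esub> (x \<oplus>\<^bsub>M\<^esub> y)) \<ominus>\<^bsub>M\<^esub> y"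
      using c by (simp add: a_minus_def M.a_assoc M.r_neg M.a_comm[of x "\<ominus>\<^bsub>M\<^esub> x'"])
    also have "\<dots> = (\<ominus>\<^bsub>M\<^esub> x' \<oplus>\<^bsub>M\<^esub> (x' \<oplus>\<^bsub>M\<^esub> y')) \<ominus>\<^bsub>M\<^esub> y" using that by simp
    also have "\<dots> = y' \<ominus>\<^bsub>M\<^esub> y" using c by (simp add: M.r_neg1)
    finally have "x \<ominus>\<^bsub>M\<^esub> x' = y' \<ominus>\<^bsub>M\<^esub> y" .
    moreover have "x \<ominus>\<^bsub>M\<^esub> x' \<in> P" "y' \<ominus>\<^bsub>M\<^esub> y \<in> Q" using that P(3,4) Q(3,4) by (auto simp: a_minus_def)
    ultimately have "x \<ominus>\<^bsub>M\<^esub> x' = \<zero>\<^bsub>M\<^esub>" using int by auto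
    then show ?thesis using c M.minus_equality[of x "\<ominus>\<^bsub>M\<^esub> x'"] by (simp add: a_minus_def)
  qed
  \<comment> \<open>The P-part is picked by choice; by \<open>uniq\<close> any decomposition of z
    gives its value.\<close>
  define p where "p z = (SOME x. x \<in> P \<and> (\<exists>y\<in>Q. z = x \<oplus>\<^bsub>M\<^esub> y))" for z
  have p: "p (x \<oplus>\<^bsub>M\<^esub> y) = x" if "x \<in> P" "y \<in> Q" for x y
    unfolding p_def by (rule some_equality) (use that uniq in blast)+
  show thesis
  proof (rule that)
    show "p x = x" if "x \<in> P" for x
      using p[OF that Q(2)] that P(1) by auto
    show "p \<in> bimodule_hom L R M (M\<lparr>carrier := P\<rparr>)"
    proof (rule bimodule_homI)
      fix z assume "z \<in> carrier M"
      then show "p z \<in> carrier (M\<lparr>carrier := P\<rparr>)" using ex[of z] p by auto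
    next
      fix z w assume "z \<in> carrier M" "w \<in> carrier M"
      then obtain x y x' y' where zw: "x \<in> P" "y \<in> Q" "z = x \<oplus>\<^bsub>M\<^esub> y" "x' \<in> P" "y' \<in> Q" "w = x' \<oplus>\<^bsub>M\<^esub> y'"
        using ex by meson
      then have c: "x \<in> carrier M" "y \<in> carrier M" "x' \<in> carrier M" "y' \<in> carrier M"
        using P(1) Q(1) by auto
      then have "z \<oplus>\<^bsub>M\<^esub> w = (x \<oplus>\<^bsub>M\<^esub> x') \<oplus>\<^bsub>M\<^esub> (y \<oplus>\<^bsub>M\<^esub> y')"
        unfolding zw by (simp add: M.a_ac)
      then show "p (z \<oplus>\<^bsub>M\<^esub> w) = p z \<oplus>\<^bsub>M\<lparr>carrier := P\<rparr>\<^esub> p w"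
        using zw p P(4) Q(4) by simp
    next
      fix a z assume "a \<in> carrier L" "z \<in> carrier M"
      then obtain x y where z: "x \<in> P" "y \<in> Q" "z = x \<oplus>\<^bsub>M\<^esub> y" using ex by meson
      then have "a \<odot>\<^bsub>M\<^esub> z = a \<odot>\<^bsub>M\<^esub> x \<oplus>\<^bsub>M\<^esub> a \<odot>\<^bsub>M\<^esub> y"
        using \<open>a \<in> carrier L\<close> P(1) Q(1) by (auto intro!: smult_r_distr)
      then show "p (a \<odot>\<^bsub>M\<^esub> z) = a \<odot>\<^bsub>M\<lparr>carrier := P\<rparr>\<^esub> p z"
        using z p P(5) Q(5) \<open>a \<in> carrier L\<close> by simp
    next
      fix z b assume "z \<in> carrier M" "b \<in> carrier R"
      then obtain x y where z: "x \<in> P" "y \<in> Q" "z = x \<oplus>\<^bsub>M\<^esub> y" using ex by meson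
      then have "z \<triangleleft>\<^bsub>M\<^esub> b = (x \<triangleleft>\<^bsub>M\<^esub> b) \<oplus>\<^bsub>M\<^esub> (y \<triangleleft>\<^bsub>M\<^esub> b)"
        using \<open>b \<in> carrier R\<close> P(1) Q(1) by (auto intro!: rsmult_l_distr)
      then show "p (z \<triangleleft>\<^bsub>M\<^esub> b) = p z \<triangleleft>\<^bsub>M\<lparr>carrier := P\<rparr>\<^esub> b"
        using z p P(6) Q(6) \<open>b \<in> carrier R\<close> by simp
    qed
  qed
qed

text \<open>The retraction projects onto the summand and then applies the inverse of the
  isomorphism. This is the form in which the depth two condition is exploited.\<close>

lemma isomorphic_to_direct_summand_retraction:
  assumes M: "bimodule L R M" and N: "bimodule L R N" and "isomorphic_to_direct_summand L R M N"
  obtains f h where "f \<in> bimodule_hom L R M N" "h \<in> bimodule_hom L R N M"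
    "\<And>x. x \<in> carrier M \<Longrightarrow> h (f x) = x"
proof -
  interpret M: bimodule L R M by (rule M)
  interpret N: bimodule L R N by (rule N)
  obtain P f where P: "direct_summand L R P N" and f: "f \<in> bimodule_hom L R M (N\<lparr>carrier := P\<rparr>)"
    and bij: "bij_betw f (carrier M) P"
    using assms(3) unfolding isomorphic_to_direct_summand_def bimodule_isomorphic_def by auto
  obtain p where p: "p \<in> bimodule_hom L R N (N\<lparr>carrier := P\<rparr>)" "\<And>x. x \<in> P \<Longrightarrow> p x = x"
    using N.direct_summand_projection[OF P] by blast
  have PN: "P \<subseteq> carrier N"
    using P subbimoduleD(1)[OF _ N.M.abelian_group_axioms] by (auto simp: direct_summand_def)
  note f = bimodule_homD[OF f, simplified] and p = bimodule_homD[OF p(1), simplified] p(2)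
  define g where "g = inv_into (carrier M) f"
  have g: "g y \<in> carrier M" "f (g y) = y" if "y \<in> P" for y
    using that bij unfolding g_def by (auto simp: bij_betw_def inv_into_into f_inv_into_f)
  have gf: "g (f x) = x" if "x \<in> carrier M" for x
    using that bij unfolding g_def by (auto simp: bij_betw_def)
  \<comment> \<open>By injectivity of f, each homomorphism law for the inverse g reduces to the
    corresponding law for f.\<close>
  have gI: "g y = x" if "x \<in> carrier M" "f x = y" for x y using gf that by auto
  show thesis
  proof (rule that)
    show "f \<in> bimodule_hom L R M N"
      by (rule bimodule_homI) (use f PN in auto)
    show "(\<lambda>y. g (p y)) \<in> bimodule_hom L R N M"
      by (rule bimodule_homI; (rule gI)?)
        (simp_all add: g p f M.smult_closed M.rsmult_closed)
    show "g (p (f x)) = x" if "x \<in> carrier M" for x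
      using that by (simp add: p f gf)
  qed
qed

lemma bimodule_restrict:
  assumes "bimodule L R M" "subring L' L" "subring R' R"
  shows "bimodule (L\<lparr>carrier := L'\<rparr>) (R\<lparr>carrier := R'\<rparr>) M"
proof -
  interpret bimodule L R M by (rule assms(1))
  have "a \<in> L' \<Longrightarrow> a \<in> carrier L" "b \<in> R' \<Longrightarrow> b \<in> carrier R" for a b
    using subringE(1)[OF assms(2)] subringE(1)[OF assms(3)] by auto
  then show ?thesis
    by (intro bimodule.intro bimodule_axioms.intro L.subring_is_ring R.subring_is_ring assms)
      (simp_all add: M.abelian_group_axioms smult_closed smult_l_distr smult_r_distr smult_assoc
        smult_one rsmult_closed rsmult_r_distr rsmult_l_distr rsmult_assoc rsmult_one smult_rsmult)
qed

lemma (in abelian_group) hom_finsum: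
  assumes M: "abelian_group M"
    and f: "\<And>x. x \<in> carrier M \<Longrightarrow> f x \<in> carrier G"
    and add: "\<And>x y. \<lbrakk>x \<in> carrier M; y \<in> carrier M\<rbrakk> \<Longrightarrow> f (x \<oplus>\<^bsub>M\<^esub> y) = f x \<oplus> f y"
    and g: "g \<in> I \<rightarrow> carrier M" and fin: "finite I"
  shows "f (finsum M g I) = (\<Oplus>i\<in>I. f (g i))"
proof -
  interpret M: abelian_group M by (rule M)
  \<comment> \<open>Additivity gives f(0) = f(0) + f(0), and cancellation in the target yields
    zero.\<close>
  have f0: "f \<zero>\<^bsub>M\<^esub> = \<zero>"
    using add[of "\<zero>\<^bsub>M\<^esub>" "\<zero>\<^bsub>M\<^esub>"] f[of "\<zero>\<^bsub>M\<^esub>"] add.l_cancel_one' by simp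
  show ?thesis
    using fin g
  proof (induction rule: finite_induct)
    case (insert i I)
    then have "finsum M g I \<in> carrier M" by (intro M.finsum_closed) auto
    with insert show ?case by (subst finsum_insert) (auto simp: add Pi_iff intro!: f)
  qed (simp add: f0)
qed


section \<open>Bimodule homomorphisms and the endomorphism coring\<close>

lemma hom_bimodule_simps:
  "carrier (hom_bimodule A B M) =
    bimodule_hom (A\<lparr>carrier := B\<rparr>) (A\<lparr>carrier := B\<rparr>) M (regular_bimodule A) \<inter> extensional (carrier M)"
  "ring.zero (hom_bimodule A B M) = (\<lambda>m\<in>carrier M. \<zero>\<^bsub>A\<^esub>)"
  "add (hom_bimodule A B M) = (\<lambda>f g. \<lambda>m\<in>carrier M. f m \<oplus>\<^bsub>A\<^esub> g m)"
  "smult (hom_bimodule A B M) = (\<lambda>r f. \<lambda>m\<in>carrier M. r \<otimes>\<^bsub>A\<^esub> f m)"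
  "rsmult (hom_bimodule A B M) = (\<lambda>f r. \<lambda>m\<in>carrier M. f m \<otimes>\<^bsub>A\<^esub> r)"
  by (simp_all add: hom_bimodule_def)

lemma hom_bimoduleD:
  assumes "f \<in> carrier (hom_bimodule A B M)"
  shows "x \<in> carrier M \<Longrightarrow> f x \<in> carrier A"
    "\<lbrakk>x \<in> carrier M; y \<in> carrier M\<rbrakk> \<Longrightarrow> f (x \<oplus>\<^bsub>M\<^esub> y) = f x \<oplus>\<^bsub>A\<^esub> f y"
    "\<lbrakk>b \<in> B; x \<in> carrier M\<rbrakk> \<Longrightarrow> f (b \<odot>\<^bsub>M\<^esub> x) = b \<otimes>\<^bsub>A\<^esub> f x"
    "\<lbrakk>x \<in> carrier M; b \<in> B\<rbrakk> \<Longrightarrow> f (x \<triangleleft>\<^bsub>M\<^esub> b) = f x \<otimes>\<^bsub>A\<^esub> b"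
  using assms bimodule_homD[of f "A\<lparr>carrier := B\<rparr>" "A\<lparr>carrier := B\<rparr>" M "regular_bimodule A"]
  by (simp_all add: hom_bimodule_simps)

lemma hom_bimoduleI:
  assumes "\<And>x. x \<in> carrier M \<Longrightarrow> f x \<in> carrier A"
    "\<And>x y. \<lbrakk>x \<in> carrier M; y \<in> carrier M\<rbrakk> \<Longrightarrow> f (x \<oplus>\<^bsub>M\<^esub> y) = f x \<oplus>\<^bsub>A\<^esub> f y"
    "\<And>b x. \<lbrakk>b \<in> B; x \<in> carrier M\<rbrakk> \<Longrightarrow> f (b \<odot>\<^bsub>M\<^esub> x) = b \<otimes>\<^bsub>A\<^esub> f x"
    "\<And>b x. \<lbrakk>x \<in> carrier M; b \<in> B\<rbrakk> \<Longrightarrow> f (x \<triangleleft>\<^bsub>M\<^esub> b) = f x \<otimes>\<^bsub>A\<^esub> b"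
    "f \<in> extensional (carrier M)"
  shows "f \<in> carrier (hom_bimodule A B M)"
  using assms unfolding hom_bimodule_simps by (intro IntI bimodule_homI) simp_all

lemma hom_bimodule_restrictI:
  assumes "bimodule (A\<lparr>carrier := B\<rparr>) (A\<lparr>carrier := B\<rparr>) M"
    "\<And>x. x \<in> carrier M \<Longrightarrow> f x \<in> carrier A"
    "\<And>x y. \<lbrakk>x \<in> carrier M; y \<in> carrier M\<rbrakk> \<Longrightarrow> f (x \<oplus>\<^bsub>M\<^esub> y) = f x \<oplus>\<^bsub>A\<^esub> f y"
    "\<And>b x. \<lbrakk>b \<in> B; x \<in> carrier M\<rbrakk> \<Longrightarrow> f (b \<odot>\<^bsub>M\<^esub> x) = b \<otimes>\<^bsub>A\<^esub> f x"
    "\<And>b x. \<lbrakk>x \<in> carrier M; b \<in> B\<rbrakk> \<Longrightarrow> f (x \<triangleleft>\<^bsub>M\<^esub> b) = f x \<otimes>\<^bsub>A\<^esub> b"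
  shows "restrict f (carrier M) \<in> carrier (hom_bimodule A B M)"
proof -
  interpret bimodule "A\<lparr>carrier := B\<rparr>" "A\<lparr>carrier := B\<rparr>" M by (rule assms(1))
  show ?thesis
    by (rule hom_bimoduleI) (use assms(2-) smult_closed rsmult_closed in simp_all)
qed

lemma End_coring_simps:
  "carrier (End_coring A B) = carrier (End_bimodule A B)"
  "ring.zero (End_coring A B) = ring.zero (End_bimodule A B)"
  "add (End_coring A B) = add (End_bimodule A B)"
  "smult (End_coring A B) = smult (End_bimodule A B)"
  "rsmult (End_coring A B) = rsmult (End_bimodule A B)"
  "counit (End_coring A B) = (\<lambda>\<alpha>. \<alpha> \<one>\<^bsub>A\<^esub>)"
  by (simp_all add: End_coring_def bimodule.defs)

text \<open>The coring record extends the bimodule record by two fields, so the two have different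
  types. The tensor group depends only on carrier, addition and actions, which agree; this lets the
  comultiplication be read on the tensor square of the coring itself.\<close>

lemma tensor_group_End_coring:
  "tensor_group R (End_bimodule A B) (End_bimodule A B) = tensor_group R (End_coring A B) (End_coring A B)"
  by (simp add: tensor_group_def tensor_kernel_def tensor_relations_def End_coring_simps)

lemma comult_End_coring:
  "comult (End_coring A B) \<alpha> = inv_into
    (carrier (tensor_product (A\<lparr>carrier := centralizer A B\<rparr>) (End_coring A B) (End_coring A B)))
    (End_tensor_to_Hom A B)
    (\<lambda>X\<in>carrier (tensor_square A B). tensor_lift A (\<lambda>a a'. \<alpha> (a \<otimes>\<^bsub>A\<^esub> a')) X)"
  by (subst End_coring_def) (simp add: bimodule.defs tensor_product_simps(1) tensor_group_End_coring)

lemma (in ring) centralizer_subring: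
  assumes "X \<subseteq> carrier R"
  shows "subring (centralizer R X) R"
proof (rule subringI)
  fix a assume "a \<in> centralizer R X"
  then show "\<ominus> a \<in> centralizer R X"
    using assms by (auto simp: centralizer_def l_minus r_minus)
next
  fix a b assume ab: "a \<in> centralizer R X" "b \<in> centralizer R X"
  have "a \<otimes> b \<otimes> x = x \<otimes> (a \<otimes> b)" if "x \<in> X" for x
  proof -
    have c: "a \<in> carrier R" "b \<in> carrier R" "x \<in> carrier R" "a \<otimes> x = x \<otimes> a" "b \<otimes> x = x \<otimes> b"
      using ab that assms by (auto simp: centralizer_def)
    then show ?thesis by (metis m_assoc)
  qed
  then show "a \<otimes> b \<in> centralizer R X" using ab by (auto simp: centralizer_def)
  show "a \<oplus> b \<in> centralizer R X"
    using ab assms by (auto simp: centralizer_def l_distr r_distr subset_iff)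
qed (use assms in \<open>auto simp: centralizer_def\<close>)

section \<open>Bimodules attached to a ring extension\<close>

locale ring_extension = ring A for A :: "('a, 'x) ring_scheme" (structure) +
  fixes B :: "'a set"
  assumes subring: "subring B A"
begin

abbreviation \<B> where "\<B> \<equiv> A\<lparr>carrier := B\<rparr>"
abbreviation C where "C \<equiv> centralizer A B"
abbreviation \<R> where "\<R> \<equiv> A\<lparr>carrier := C\<rparr>"
abbreviation Areg where "Areg \<equiv> regular_bimodule A"
abbreviation AA where "AA \<equiv> tensor_square A B"
abbreviation S where "S \<equiv> End_coring A B"
abbreviation SS where "SS \<equiv> tensor_product \<R> S S"
abbreviation SSS where "SSS \<equiv> tensor_product \<R> S SS"
abbreviation H where "H \<equiv> hom_bimodule A B AA"
abbreviation ptensor where "ptensor \<equiv> pure_tensor \<B> Areg Areg"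

lemma B_carrier: "b \<in> B \<Longrightarrow> b \<in> carrier A"
  using subringE(1)[OF subring] by auto

lemma C_subring: "subring C A"
  using B_carrier by (intro centralizer_subring) auto

lemma C_carrier: "r \<in> C \<Longrightarrow> r \<in> carrier A"
  by (simp add: centralizer_def)

lemma C_commute: "\<lbrakk>r \<in> C; b \<in> B\<rbrakk> \<Longrightarrow> r \<otimes> b = b \<otimes> r"
  by (simp add: centralizer_def)

lemma C_left_commute: "\<lbrakk>r \<in> C; b \<in> B; a \<in> carrier A\<rbrakk> \<Longrightarrow> r \<otimes> (b \<otimes> a) = b \<otimes> (r \<otimes> a)"
  by (simp add: m_assoc[symmetric] C_carrier B_carrier C_commute)

text \<open>Scalars must come from the centralizer: r f is still left B-linear because r can be
  moved past elements of B (\<open>C_left_commute\<close>), and f r is still right B-linear by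
  \<open>C_commute\<close>.\<close>

lemma bimodule_hom_bimodule:
  assumes "bimodule \<B> \<B> M"
  shows "bimodule \<R> \<R> (hom_bimodule A B M)"
proof -
  interpret M: bimodule \<B> \<B> M by (rule assms)
  let ?H = "hom_bimodule A B M"
  have ext: "f \<in> extensional (carrier M)" if "f \<in> carrier ?H" for f
    using that by (simp add: hom_bimodule_simps)
  note D = hom_bimoduleD
  have ag: "abelian_group ?H"
  proof (rule abelian_groupI)
    fix f g assume "f \<in> carrier ?H" "g \<in> carrier ?H"
    note fg = D[OF this(1)] D[OF this(2)]
    show "f \<oplus>\<^bsub>?H\<^esub> g \<in> carrier ?H"
      unfolding hom_bimodule_simps(3)
      by (rule hom_bimodule_restrictI)
        (simp_all add: fg assms a_ac l_distr r_distr B_carrier M.smult_closed M.rsmult_closed)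
    show "f \<oplus>\<^bsub>?H\<^esub> g = g \<oplus>\<^bsub>?H\<^esub> f"
      by (auto simp: hom_bimodule_simps fg a_ac)
  next
    show "\<zero>\<^bsub>?H\<^esub> \<in> carrier ?H"
      unfolding hom_bimodule_simps(2)
      by (rule hom_bimodule_restrictI) (simp_all add: assms B_carrier)
  next
    fix f g h assume "f \<in> carrier ?H" "g \<in> carrier ?H" "h \<in> carrier ?H"
    note fgh = D[OF this(1)] D[OF this(2)] D[OF this(3)]
    show "(f \<oplus>\<^bsub>?H\<^esub> g) \<oplus>\<^bsub>?H\<^esub> h = f \<oplus>\<^bsub>?H\<^esub> (g \<oplus>\<^bsub>?H\<^esub> h)"
      by (auto simp: hom_bimodule_simps fgh a_ac)
  next
    fix f assume f': "f \<in> carrier ?H"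
    note f = D[OF this]
    show "\<zero>\<^bsub>?H\<^esub> \<oplus>\<^bsub>?H\<^esub> f = f"
      using ext[OF f'] by (intro extensionalityI[of _ "carrier M"]) (simp_all add: hom_bimodule_simps f)
    have "restrict (\<lambda>m. \<ominus> f m) (carrier M) \<in> carrier ?H"
      by (rule hom_bimodule_restrictI) (simp_all add: f assms minus_add l_minus r_minus B_carrier)
    then show "\<exists>g\<in>carrier ?H. g \<oplus>\<^bsub>?H\<^esub> f = \<zero>\<^bsub>?H\<^esub>"
      by (rule bexI[rotated]) (auto simp: hom_bimodule_simps f l_neg)
  qed
  show ?thesis
  proof (intro bimodule.intro bimodule_axioms.intro subring_is_ring C_subring ag)
    fix r f assume r: "r \<in> carrier \<R>" and f: "f \<in> carrier ?H"
    note f = D[OF f]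
    show "r \<odot>\<^bsub>?H\<^esub> f \<in> carrier ?H"
      unfolding hom_bimodule_simps(4)
      by (rule hom_bimodule_restrictI)
        (use r in \<open>simp_all add: f assms r_distr C_carrier m_assoc B_carrier C_left_commute\<close>)
  next
    fix r f assume r: "r \<in> carrier \<R>" and f: "f \<in> carrier ?H"
    note f = D[OF f]
    show "f \<triangleleft>\<^bsub>?H\<^esub> r \<in> carrier ?H"
      unfolding hom_bimodule_simps(5)
      by (rule hom_bimodule_restrictI)
        (use r in \<open>simp_all add: f assms l_distr C_carrier m_assoc B_carrier C_commute\<close>)
  next
    fix f assume f: "f \<in> carrier ?H"
    show "\<one>\<^bsub>\<R>\<^esub> \<odot>\<^bsub>?H\<^esub> f = f" "f \<triangleleft>\<^bsub>?H\<^esub> \<one>\<^bsub>\<R>\<^esub> = f"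
      using ext[OF f] D[OF f]
      by (auto intro!: extensionalityI[of _ "carrier M"] simp: hom_bimodule_simps)
  qed (auto simp: hom_bimodule_simps(3-5) D C_carrier l_distr r_distr m_assoc fun_eq_iff restrict_def)
qed

text \<open>Balancing is over B, while both outer actions are by all of A. The A-B and B-B
  structures are later obtained from this A-A-bimodule by restricting scalars.\<close>

sublocale AA: bimodule_pair A \<B> A Areg Areg
  rewrites "tensor_product \<B> Areg Areg \<equiv> AA"
proof -
  show "bimodule_pair A \<B> A Areg Areg"
    using bimodule_regular[OF carrier_is_subring subring] bimodule_regular[OF subring carrier_is_subring]
    by (simp add: bimodule_pair_def)
qed (simp add: tensor_square_def)

lemma bimodule_AA: "bimodule A A AA"
  by (rule AA.bimodule_tensor)

lemma bimodule_AA_B: "bimodule \<B> \<B> AA"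
  by (rule bimodule_restrict[OF bimodule_AA subring subring])

text \<open>Carrier, addition and actions coincide with those of \<open>End_bimodule\<close>, so the
  structure is transported field by field to the coring record.\<close>

lemma bimodule_S: "bimodule \<R> \<R> S"
proof -
  have "bimodule \<R> \<R> (End_bimodule A B)"
    unfolding End_bimodule_def by (intro bimodule_hom_bimodule bimodule_regular subring)
  then interpret E: bimodule \<R> \<R> "End_bimodule A B" .
  have "abelian_group S"
    using abelian_groupE[OF E.M.abelian_group_axioms]
    by (intro abelian_groupI) (simp_all only: End_coring_simps)
  then show ?thesis
    by (intro bimodule.intro bimodule_axioms.intro E.L.ring_axioms)
      (simp_all only: End_coring_simps E.smult_closed E.smult_l_distr E.smult_r_distr E.smult_assoc
        E.smult_one E.rsmult_closed E.rsmult_r_distr E.rsmult_l_distr E.rsmult_assoc E.rsmult_one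
        E.smult_rsmult)
qed

sublocale S: bimodule \<R> \<R> S by (rule bimodule_S)

sublocale H: bimodule \<R> \<R> H by (rule bimodule_hom_bimodule[OF bimodule_AA_B])

sublocale SS: bimodule_pair \<R> \<R> \<R> S S
  by (intro bimodule_pair.intro bimodule_S)

sublocale SSS: bimodule_pair \<R> \<R> \<R> S SS
  by (intro bimodule_pair.intro bimodule_S SS.bimodule_tensor)

section \<open>Elements of S as functions, invariants and projections\<close>

lemma S_carrier: "carrier S = carrier (hom_bimodule A B Areg)"
  by (simp add: End_coring_simps End_bimodule_def)

lemmas S_hom = hom_bimoduleD[of _ A B Areg, folded S_carrier, unfolded regular_bimodule_simps]

lemma S_apply:
  assumes "a \<in> carrier A"
  shows "(\<alpha> \<oplus>\<^bsub>S\<^esub> \<beta>) a = \<alpha> a \<oplus> \<beta> a" "(r \<odot>\<^bsub>S\<^esub> \<alpha>) a = r \<otimes> \<alpha> a" "(\<alpha> \<triangleleft>\<^bsub>S\<^esub> r) a = \<alpha> a \<otimes> r"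
  using assms by (simp_all add: End_coring_simps End_bimodule_def hom_bimodule_simps)

lemma S_eqI:
  assumes "\<alpha> \<in> carrier S" "\<beta> \<in> carrier S" "\<And>a. a \<in> carrier A \<Longrightarrow> \<alpha> a = \<beta> a"
  shows "\<alpha> = \<beta>"
  using assms by (intro extensionalityI[of _ "carrier A"]) (simp_all add: S_carrier hom_bimodule_simps)

lemma S_restrictI:
  assumes "\<And>x. x \<in> carrier A \<Longrightarrow> f x \<in> carrier A"
    "\<And>x y. \<lbrakk>x \<in> carrier A; y \<in> carrier A\<rbrakk> \<Longrightarrow> f (x \<oplus> y) = f x \<oplus> f y"
    "\<And>b x. \<lbrakk>b \<in> B; x \<in> carrier A\<rbrakk> \<Longrightarrow> f (b \<otimes> x) = b \<otimes> f x"
    "\<And>b x. \<lbrakk>x \<in> carrier A; b \<in> B\<rbrakk> \<Longrightarrow> f (x \<otimes> b) = f x \<otimes> b"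
  shows "restrict f (carrier A) \<in> carrier S"
  using hom_bimodule_restrictI[OF bimodule_regular[OF subring subring], of f] assms
  by (simp add: S_carrier)

text \<open>For b in B, bilinearity gives b \<alpha>(1) = \<alpha>(b) = \<alpha>(1) b. This is why
  the counit takes its values in R.\<close>

lemma S_one: "\<alpha> \<in> carrier S \<Longrightarrow> \<alpha> \<one> \<in> C"
  using S_hom(3)[of \<alpha> _ \<one>] S_hom(4)[of \<alpha> \<one>] S_hom(1)[of \<alpha> \<one>] B_carrier
  by (auto simp: centralizer_def)

text \<open>The double centralizer condition enters here: invariance read at a point a says that
  e(a) commutes with R, which places e(a) in B.\<close>

lemma cosplit_imp_split:
  assumes "centralizer A C = B" and "cosplit_coring \<R> S"
  shows "split_extension A B"
proof -
  obtain e where e: "e \<in> carrier S" "\<And>r. r \<in> C \<Longrightarrow> r \<odot>\<^bsub>S\<^esub> e = e \<triangleleft>\<^bsub>S\<^esub> r" "e \<one> = \<one>"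
    using assms(2) by (auto simp: cosplit_coring_def bimodule_invariants_def End_coring_simps(6))
  have eB: "e a \<in> B" if a: "a \<in> carrier A" for a
  proof -
    have "e a \<otimes> r = r \<otimes> e a" if "r \<in> C" for r
      using S_apply(2,3)[OF a] e(2)[OF that] by metis
    then have "e a \<in> centralizer A C" using S_hom(1)[OF e(1) a] by (auto simp: centralizer_def[of A C])
    then show ?thesis using assms(1) by simp
  qed
  \<comment> \<open>Left B-linearity together with e(1) = 1 makes e the identity on B, hence e maps
    onto B.\<close>
  have "e b = b" if "b \<in> B" for b
    using S_hom(3)[OF e(1) that one_closed] e(3) B_carrier[OF that] by simp
  then have "B \<subseteq> e ` carrier A" using B_carrier by (metis imageI subsetI)
  then have "e ` carrier A = B" using eB by auto
  moreover have "e \<in> bimodule_hom \<B> \<B> Areg (regular_bimodule \<B>)"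
    by (rule bimodule_homI) (simp_all add: eB S_hom[OF e(1)])
  ultimately show ?thesis using e(3) unfolding split_extension_def by auto
qed

text \<open>Elements of R commute with B by definition, so a map with values in B is automatically
  invariant.\<close>

lemma split_imp_invariant:
  assumes "split_extension A B"
  shows "\<exists>e\<in>bimodule_invariants \<R> S. counit S e = \<one>"
proof -
  obtain E where E: "E \<in> bimodule_hom \<B> \<B> Areg (regular_bimodule \<B>)" "E \<one> = \<one>"
    using assms by (auto simp: split_extension_def)
  note h = bimodule_homD[OF E(1), simplified]
  \<comment> \<open>Elements of S are extensional, whereas E is arbitrary outside the
    carrier.\<close>
  let ?e = "restrict E (carrier A)"
  have e: "?e \<in> carrier S" by (rule S_restrictI) (simp_all add: h B_carrier)
  have "r \<odot>\<^bsub>S\<^esub> ?e = ?e \<triangleleft>\<^bsub>S\<^esub> r" if "r \<in> C" for r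
    by (rule S_eqI) (use that e in \<open>simp_all add: S.smult_closed S.rsmult_closed S_apply h C_commute[OF that]\<close>)
  with e show ?thesis
    by (intro bexI[of _ ?e]) (simp_all add: bimodule_invariants_def End_coring_simps(6) E)
qed


subsection \<open>Quasi-bases\<close>

text \<open>The A-B-bimodule half of depth two gives f into A^n and a retraction h. Then u_j is the
  image under h of the j-th standard vector and \<gamma>_j(a) is the j-th coordinate of f(1
  \<otimes> a).\<close>

lemma depth_two_quasi_basis:
  assumes "depth_two A B"
  obtains n :: nat and \<gamma> u where "\<And>j. j < n \<Longrightarrow> \<gamma> j \<in> carrier S"
    "\<And>j. j < n \<Longrightarrow> u j \<in> carrier AA"
    "\<And>j b. \<lbrakk>j < n; b \<in> B\<rbrakk> \<Longrightarrow> b \<odot>\<^bsub>AA\<^esub> u j = u j \<triangleleft>\<^bsub>AA\<^esub> b"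
    "\<And>a. a \<in> carrier A \<Longrightarrow> ptensor \<one> a = (\<Oplus>\<^bsub>AA\<^esub>j\<in>{..<n}. \<gamma> j a \<odot>\<^bsub>AA\<^esub> u j)"
proof -
  interpret AAB: bimodule A \<B> AA
    using bimodule_restrict[OF bimodule_AA carrier_is_subring subring] by simp
  obtain n where n: "isomorphic_to_direct_summand A \<B> AA (direct_power n Areg)"
    using assms by (auto simp: depth_two_def)
  let ?P = "direct_power n Areg"
  interpret P: bimodule A \<B> ?P by (rule AA.M.bimodule_direct_power)
  obtain f h where f: "f \<in> bimodule_hom A \<B> AA ?P" and h: "h \<in> bimodule_hom A \<B> ?P AA"
    and hf: "\<And>X. X \<in> carrier AA \<Longrightarrow> h (f X) = X"
    using isomorphic_to_direct_summand_retraction[OF AAB.bimodule_axioms P.bimodule_axioms n] by blast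
  note f = bimodule_homD[OF f] and h = bimodule_homD[OF h]
  have fc: "f X j \<in> carrier A" if "X \<in> carrier AA" "j < n" for X j
    using f(1)[OF that(1)] that(2) by (auto simp: PiE_iff)
  define e where "e j = (\<lambda>i\<in>{..<n}. if i = j then \<one> else \<zero>)" for j
  have e: "e j \<in> carrier ?P" for j by (auto simp: e_def)
  define u where "u j = h (e j)" for j
  have u: "u j \<in> carrier AA" for j unfolding u_def by (rule h(1)[OF e])
  have h_sum: "h y = (\<Oplus>\<^bsub>AA\<^esub>j\<in>{..<n}. y j \<odot>\<^bsub>AA\<^esub> u j)" if y: "y \<in> carrier ?P" for y
  proof -
    have yc: "y j \<in> carrier A" if "j < n" for j using y that by (auto simp: PiE_iff)
    \<comment> \<open>Truncations of y to its first k coordinates: each step adds one multiple of a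
      standard vector, so additivity and left A-linearity of h give the sum by induction on
      k.\<close>
    let ?t = "\<lambda>k. \<lambda>i\<in>{..<n}. if i < k then y i else \<zero>"
    have main: "h (?t k) = (\<Oplus>\<^bsub>AA\<^esub>j\<in>{..<k}. y j \<odot>\<^bsub>AA\<^esub> u j)" if "k \<le> n" for k
      using that
    proof (induction k)
      case 0
      have t0: "?t 0 = \<zero>\<^bsub>?P\<^esub>" by auto
      have h0: "h \<zero>\<^bsub>?P\<^esub> = \<zero>\<^bsub>AA\<^esub>"
        using h(2)[OF P.M.zero_closed P.M.zero_closed] AA.T.add.l_cancel_one' h(1)[OF P.M.zero_closed]
        by (simp only: P.M.l_zero[OF P.M.zero_closed])
      show ?case unfolding t0 h0 by simp
    next
      case (Suc k)
      have tk: "?t k \<in> carrier ?P" using yc by auto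
      have yk: "y k \<in> carrier A" using yc Suc by simp
      have "?t (Suc k) = ?t k \<oplus>\<^bsub>?P\<^esub> (y k \<odot>\<^bsub>?P\<^esub> e k)"
        using Suc.prems yc by (auto simp: e_def fun_eq_iff less_Suc_eq)
      then have "h (?t (Suc k)) = h (?t k) \<oplus>\<^bsub>AA\<^esub> (y k \<odot>\<^bsub>AA\<^esub> u k)"
        using h(2)[OF tk P.smult_closed[OF yk e]] h(3)[OF yk e] by (simp only: u_def)
      also have "\<dots> = (\<Oplus>\<^bsub>AA\<^esub>j\<in>{..<k}. y j \<odot>\<^bsub>AA\<^esub> u j) \<oplus>\<^bsub>AA\<^esub> (y k \<odot>\<^bsub>AA\<^esub> u k)"
        using Suc.IH Suc.prems by (simp only: Suc_leD)
      also have "\<dots> = (\<Oplus>\<^bsub>AA\<^esub>j\<in>{..<Suc k}. y j \<odot>\<^bsub>AA\<^esub> u j)"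
        unfolding lessThan_Suc using Suc.prems yc u
        by (subst AA.T.finsum_insert) (auto intro!: AA.T.a_comm AAB.smult_closed AA.T.finsum_closed)
      finally show ?case .
    qed
    have "?t n = y" using y by (auto simp: PiE_iff extensional_def fun_eq_iff)
    then show ?thesis using main[OF order_refl] by (simp only:)
  qed
  define \<gamma> where "\<gamma> j = (\<lambda>a\<in>carrier A. f (ptensor \<one> a) j)" for j
  show thesis
  proof (rule that)
    fix j assume j: "j < n"
    show "u j \<in> carrier AA" by (rule u)
    show "b \<odot>\<^bsub>AA\<^esub> u j = u j \<triangleleft>\<^bsub>AA\<^esub> b" if "b \<in> B" for b
    proof -
      \<comment> \<open>Both products have b in position j and zero elsewhere; applying h transfers
        this equality to u_j.\<close>
      have "b \<odot>\<^bsub>?P\<^esub> e j = e j \<triangleleft>\<^bsub>?P\<^esub> b"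
        using B_carrier[OF that] by (auto simp: e_def)
      then show ?thesis
        using h(3)[OF B_carrier[OF that] e[of j]] h(4)[OF e[of j], of b] that by (simp add: u_def)
    qed
    show "\<gamma> j \<in> carrier S"
      unfolding \<gamma>_def
    proof (rule S_restrictI)
      fix x assume x: "x \<in> carrier A"
      show "f (ptensor \<one> x) j \<in> carrier A" by (rule fc) (use x j in auto)
      fix y assume y: "y \<in> carrier A"
      show "f (ptensor \<one> (x \<oplus> y)) j = f (ptensor \<one> x) j \<oplus> f (ptensor \<one> y) j"
        using AA.pure_add_right[of \<one> x y] f(2)[of "ptensor \<one> x" "ptensor \<one> y"] x y j by simp
    next
      fix b x assume b: "b \<in> B" and x: "x \<in> carrier A"
      \<comment> \<open>An element of B crosses the tensor sign and then acts on the left factor 1,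
        where it agrees with the outer left action.\<close>
      have "ptensor \<one> (b \<otimes> x) = b \<odot>\<^bsub>AA\<^esub> ptensor \<one> x"
        using AA.pure_balanced[of \<one> b x] AA.smult_pure[of b \<one> x] b x B_carrier by simp
      then show "f (ptensor \<one> (b \<otimes> x)) j = b \<otimes> f (ptensor \<one> x) j"
        using f(3)[OF B_carrier[OF b], of "ptensor \<one> x"] x j by simp
    next
      fix b x assume b: "b \<in> B" and x: "x \<in> carrier A"
      have "ptensor \<one> (x \<otimes> b) = ptensor \<one> x \<triangleleft>\<^bsub>AA\<^esub> b"
        using AA.rsmult_pure[of b \<one> x] b x B_carrier by simp
      then show "f (ptensor \<one> (x \<otimes> b)) j = f (ptensor \<one> x) j \<otimes> b"
        using f(4)[of "ptensor \<one> x" b] b x j by simp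
    qed
  next
    fix a assume a: "a \<in> carrier A"
    then have p: "ptensor \<one> a \<in> carrier AA" by simp
    have "ptensor \<one> a = (\<Oplus>\<^bsub>AA\<^esub>j\<in>{..<n}. f (ptensor \<one> a) j \<odot>\<^bsub>AA\<^esub> u j)"
      using h_sum[OF f(1)[OF p]] unfolding hf[OF p] .
    also have "\<dots> = (\<Oplus>\<^bsub>AA\<^esub>j\<in>{..<n}. \<gamma> j a \<odot>\<^bsub>AA\<^esub> u j)"
      by (rule AA.T.finsum_cong') (simp_all add: \<gamma>_def a fc[OF p] AAB.smult_closed u Pi_iff)
    finally show "ptensor \<one> a = (\<Oplus>\<^bsub>AA\<^esub>j\<in>{..<n}. \<gamma> j a \<odot>\<^bsub>AA\<^esub> u j)" .
  qed
qed

section \<open>Contraction of tensors with left B-linear maps\<close>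

definition left_linear :: "('a \<Rightarrow> 'a) \<Rightarrow> bool" where
  "left_linear \<phi> \<longleftrightarrow> (\<forall>x\<in>carrier A. \<phi> x \<in> carrier A) \<and>
    (\<forall>x\<in>carrier A. \<forall>y\<in>carrier A. \<phi> (x \<oplus> y) = \<phi> x \<oplus> \<phi> y) \<and>
    (\<forall>b\<in>B. \<forall>x\<in>carrier A. \<phi> (b \<otimes> x) = b \<otimes> \<phi> x)"

lemma left_linearI:
  assumes "\<And>x. x \<in> carrier A \<Longrightarrow> \<phi> x \<in> carrier A"
    "\<And>x y. \<lbrakk>x \<in> carrier A; y \<in> carrier A\<rbrakk> \<Longrightarrow> \<phi> (x \<oplus> y) = \<phi> x \<oplus> \<phi> y"
    "\<And>b x. \<lbrakk>b \<in> B; x \<in> carrier A\<rbrakk> \<Longrightarrow> \<phi> (b \<otimes> x) = b \<otimes> \<phi> x"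
  shows "left_linear \<phi>"
  using assms by (simp add: left_linear_def)

lemma left_linearD:
  assumes "left_linear \<phi>"
  shows "x \<in> carrier A \<Longrightarrow> \<phi> x \<in> carrier A"
    "\<lbrakk>x \<in> carrier A; y \<in> carrier A\<rbrakk> \<Longrightarrow> \<phi> (x \<oplus> y) = \<phi> x \<oplus> \<phi> y"
    "\<lbrakk>b \<in> B; x \<in> carrier A\<rbrakk> \<Longrightarrow> \<phi> (b \<otimes> x) = b \<otimes> \<phi> x"
  using assms by (simp_all add: left_linear_def)

lemma S_left_linear: "\<alpha> \<in> carrier S \<Longrightarrow> left_linear \<alpha>"
  by (rule left_linearI) (simp_all add: S_hom)

text \<open>This is id \<otimes> \<phi> followed by multiplication in A. Left B-linearity of \<phi>
  makes it well defined over B.\<close>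

definition contract :: "('a \<Rightarrow> 'a) \<Rightarrow> ('a, 'a) tensor \<Rightarrow> 'a" where
  "contract \<phi> = tensor_lift A (\<lambda>x y. x \<otimes> \<phi> y)"

context
  fixes \<phi> assumes \<phi>: "left_linear \<phi>"
begin

private lemma contract_balanced: "balanced_map \<B> Areg Areg A (\<lambda>x y. x \<otimes> \<phi> y)"
  by (rule balanced_mapI) (simp_all add: left_linearD[OF \<phi>] l_distr r_distr m_assoc B_carrier)

lemma contract_closed: "X \<in> carrier AA \<Longrightarrow> contract \<phi> X \<in> carrier A"
  unfolding contract_def by (rule AA.tensor_lift_closed[OF is_abelian_group contract_balanced])

lemma contract_pure: "\<lbrakk>x \<in> carrier A; y \<in> carrier A\<rbrakk> \<Longrightarrow> contract \<phi> (ptensor x y) = x \<otimes> \<phi> y"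
  unfolding contract_def by (rule AA.tensor_lift_pure[OF is_abelian_group contract_balanced]) simp_all

lemma contract_add:
  "\<lbrakk>X \<in> carrier AA; Y \<in> carrier AA\<rbrakk> \<Longrightarrow> contract \<phi> (X \<oplus>\<^bsub>AA\<^esub> Y) = contract \<phi> X \<oplus> contract \<phi> Y"
  unfolding contract_def by (rule AA.tensor_lift_add[OF is_abelian_group contract_balanced])

lemma contract_smult:
  assumes "a \<in> carrier A" "X \<in> carrier AA"
  shows "contract \<phi> (a \<odot>\<^bsub>AA\<^esub> X) = a \<otimes> contract \<phi> X"
  using assms(2) by (induction rule: AA.tensor_induct)
    (use assms(1) in \<open>simp_all add: AA.smult_pure contract_pure left_linearD[OF \<phi>] m_assoc
      AA.tensor_smult_add AA.tensor_smult_closed contract_add contract_closed r_distr\<close>)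

end

lemma contract_eqI:
  assumes "left_linear \<phi>" "left_linear \<psi>" "\<And>x. x \<in> carrier A \<Longrightarrow> \<phi> x = \<psi> x" "X \<in> carrier AA"
  shows "contract \<phi> X = contract \<psi> X"
  using assms(4) by (induction rule: AA.tensor_induct)
    (simp_all add: assms contract_pure contract_add)

text \<open>The relation between the maps is required pointwise on the carrier, so it covers
  extensional elements of S as well as maps written with a lambda.\<close>

lemma contract_plus:
  assumes "left_linear \<phi>" "left_linear \<psi>" "left_linear \<chi>"
    and "\<And>x. x \<in> carrier A \<Longrightarrow> \<chi> x = \<phi> x \<oplus> \<psi> x" "X \<in> carrier AA"
  shows "contract \<chi> X = contract \<phi> X \<oplus> contract \<psi> X"
  using assms(5) by (induction rule: AA.tensor_induct)
    (simp_all add: assms(1-4) contract_pure contract_add contract_closed left_linearD r_distr a_ac)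

lemma contract_mult_right:
  assumes "left_linear \<phi>" "left_linear \<psi>" "\<And>x. x \<in> carrier A \<Longrightarrow> \<psi> x = \<phi> x \<otimes> c"
    and "c \<in> carrier A" "X \<in> carrier AA"
  shows "contract \<psi> X = contract \<phi> X \<otimes> c"
  using assms(5) by (induction rule: AA.tensor_induct)
    (simp_all add: assms(1-4) contract_pure contract_add contract_closed left_linearD m_assoc l_distr)

text \<open>The right action on the tensor square reaches the second factor, to which \<phi> is
  applied. Combined with \<open>u_central\<close> and \<open>contract_smult\<close>, this moves
  elements of B from the argument of the map to the left of the contraction.\<close>

lemma contract_rsmult:
  assumes "left_linear \<phi>" "left_linear \<psi>" "\<And>x. x \<in> carrier A \<Longrightarrow> \<psi> x = \<phi> (x \<otimes> c)"
    and "c \<in> carrier A" "X \<in> carrier AA"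
  shows "contract \<psi> X = contract \<phi> (X \<triangleleft>\<^bsub>AA\<^esub> c)"
  using assms(5) by (induction rule: AA.tensor_induct)
    (simp_all add: assms(1-4) contract_pure contract_add AA.rsmult_pure AA.tensor_rsmult_add
      AA.tensor_rsmult_closed)

section \<open>Evaluation of tensors over R\<close>

definition tensor_eval :: "('n \<Rightarrow> 'a) \<Rightarrow> ('a \<Rightarrow> 'a, 'n) tensor \<Rightarrow> 'a \<Rightarrow> 'a" where
  "tensor_eval e X a = tensor_lift A (\<lambda>\<alpha> y. \<alpha> a \<otimes> e y) X"

text \<open>Left R-linearity of e is what makes the map \<alpha>, y to \<alpha>(a) e(y) balanced
  over R, so that \<open>tensor_eval e\<close> is well defined.\<close>

definition linear_form :: "('a, 'n, 'a, 'z) bimodule_scheme \<Rightarrow> ('n \<Rightarrow> 'a) \<Rightarrow> bool" where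
  "linear_form N e \<longleftrightarrow> (\<forall>x\<in>carrier N. e x \<in> carrier A) \<and>
    (\<forall>x\<in>carrier N. \<forall>y\<in>carrier N. e (x \<oplus>\<^bsub>N\<^esub> y) = e x \<oplus> e y) \<and>
    (\<forall>r\<in>C. \<forall>x\<in>carrier N. e (r \<odot>\<^bsub>N\<^esub> x) = r \<otimes> e x)"

lemma linear_formD:
  assumes "linear_form N e"
  shows "x \<in> carrier N \<Longrightarrow> e x \<in> carrier A"
    "\<lbrakk>x \<in> carrier N; y \<in> carrier N\<rbrakk> \<Longrightarrow> e (x \<oplus>\<^bsub>N\<^esub> y) = e x \<oplus> e y"
    "\<lbrakk>r \<in> C; x \<in> carrier N\<rbrakk> \<Longrightarrow> e (r \<odot>\<^bsub>N\<^esub> x) = r \<otimes> e x"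
  using assms by (simp_all add: linear_form_def)

lemma linear_form_S: "a \<in> carrier A \<Longrightarrow> linear_form S (\<lambda>\<alpha>. \<alpha> a)"
  by (simp add: linear_form_def S_hom S_apply)

context
  fixes N :: "('a, 'n, 'a, 'z) bimodule_scheme" and e
  assumes N: "bimodule \<R> \<R> N" and e: "linear_form N e"
begin

interpretation SN: bimodule_pair \<R> \<R> \<R> S N
  by (intro bimodule_pair.intro bimodule_S N)

private lemma tensor_eval_balanced:
  "a \<in> carrier A \<Longrightarrow> balanced_map \<R> S N A (\<lambda>\<alpha> y. \<alpha> a \<otimes> e y)"
  by (rule balanced_mapI)
    (simp_all add: linear_formD[OF e] S_hom S_apply l_distr r_distr m_assoc C_carrier)

lemma tensor_eval_closed:
  "\<lbrakk>X \<in> carrier (tensor_product \<R> S N); a \<in> carrier A\<rbrakk> \<Longrightarrow> tensor_eval e X a \<in> carrier A"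
  unfolding tensor_eval_def by (rule SN.tensor_lift_closed[OF is_abelian_group tensor_eval_balanced])

lemma tensor_eval_pure:
  "\<lbrakk>\<alpha> \<in> carrier S; y \<in> carrier N; a \<in> carrier A\<rbrakk> \<Longrightarrow>
    tensor_eval e (pure_tensor \<R> S N \<alpha> y) a = \<alpha> a \<otimes> e y"
  unfolding tensor_eval_def by (rule SN.tensor_lift_pure[OF is_abelian_group tensor_eval_balanced])

lemma tensor_eval_add:
  "\<lbrakk>X \<in> carrier (tensor_product \<R> S N); Y \<in> carrier (tensor_product \<R> S N); a \<in> carrier A\<rbrakk> \<Longrightarrow>
    tensor_eval e (X \<oplus>\<^bsub>tensor_product \<R> S N\<^esub> Y) a = tensor_eval e X a \<oplus> tensor_eval e Y a"
  unfolding tensor_eval_def by (rule SN.tensor_lift_add[OF is_abelian_group tensor_eval_balanced])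

text \<open>As a function of a, the evaluation inherits left B-linearity from the first factor.
  Hence an evaluated tensor can itself be contracted with the u_j.\<close>

lemma tensor_eval_left_linear:
  assumes "X \<in> carrier (tensor_product \<R> S N)"
  shows "left_linear (tensor_eval e X)"
  using assms
proof (induction rule: SN.tensor_induct)
  case (pure \<alpha> y)
  then show ?case
    by (intro left_linearI)
      (simp_all add: tensor_eval_pure S_hom linear_formD[OF e] l_distr m_assoc B_carrier)
next
  case (add X Y)
  then show ?case
    by (intro left_linearI)
      (simp_all add: tensor_eval_add tensor_eval_closed left_linearD a_ac r_distr B_carrier)
qed

text \<open>An evaluation at a fixed point is again a linear form, so the construction can be
  iterated along further tensor factors.\<close>

lemma tensor_eval_linear_form:
  assumes a: "a \<in> carrier A"
  shows "linear_form (tensor_product \<R> S N) (\<lambda>X. tensor_eval e X a)"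
proof -
  have "tensor_eval e (r \<odot>\<^bsub>tensor_product \<R> S N\<^esub> X) a = r \<otimes> tensor_eval e X a"
    if r: "r \<in> C" and "X \<in> carrier (tensor_product \<R> S N)" for r X
    using that(2)
  proof (induction rule: SN.tensor_induct)
    case (pure \<alpha> y)
    then show ?case
      using a r by (simp add: SN.smult_pure S.smult_closed tensor_eval_pure S_apply m_assoc S_hom
          linear_formD[OF e] C_carrier)
  next
    case (add X Y)
    then show ?case
      using a r by (simp add: SN.tensor_smult_add SN.tensor_smult_closed tensor_eval_add
          tensor_eval_closed r_distr C_carrier)
  qed
  then show ?thesis using a by (simp add: linear_form_def tensor_eval_closed tensor_eval_add)
qed

end

text \<open>Elements of S \<otimes> S become functions of two variables and elements of S \<otimes>
  (S \<otimes> S) functions of three. The comultiplication laws are compared in this form.\<close>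

abbreviation eval2 where "eval2 X a b \<equiv> tensor_eval (\<lambda>\<beta>. \<beta> b) X a"
abbreviation eval3 where "eval3 X a b c \<equiv> tensor_eval (\<lambda>Y. eval2 Y b c) X a"

lemmas eval2_closed = tensor_eval_closed[OF bimodule_S linear_form_S]
lemmas eval2_pure = tensor_eval_pure[OF bimodule_S linear_form_S]
lemmas eval2_add = tensor_eval_add[OF bimodule_S linear_form_S]
lemmas eval2_linear_form = tensor_eval_linear_form[OF bimodule_S linear_form_S]
lemmas eval3_pure = tensor_eval_pure[OF SS.bimodule_tensor eval2_linear_form]
lemmas eval3_add = tensor_eval_add[OF SS.bimodule_tensor eval2_linear_form]

lemma eval2_rsmult:
  assumes "X \<in> carrier SS" "r \<in> C" "a \<in> carrier A" "b \<in> carrier A"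
  shows "eval2 (X \<triangleleft>\<^bsub>SS\<^esub> r) a b = eval2 X a b \<otimes> r"
  using assms(1) by (induction rule: SS.tensor_induct)
    (use assms(2-) in \<open>simp_all add: SS.rsmult_pure S.rsmult_closed eval2_pure S_apply S_hom m_assoc
      C_carrier SS.tensor_rsmult_add SS.tensor_rsmult_closed eval2_add eval2_closed l_distr\<close>)

section \<open>The canonical map from S \<otimes> S to bimodule maps\<close>

lemma H_eqI:
  assumes "f \<in> carrier H" "g \<in> carrier H"
    and "\<And>a b. \<lbrakk>a \<in> carrier A; b \<in> carrier A\<rbrakk> \<Longrightarrow> f (ptensor a b) = g (ptensor a b)"
  shows "f = g"
proof (rule extensionalityI[of _ "carrier AA"])
  fix X assume X: "X \<in> carrier AA"
  show "f X = g X"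
    by (rule AA.tensor_hom_eqI[where G = A])
      (simp_all add: assms(3) hom_bimoduleD[OF assms(1)] hom_bimoduleD[OF assms(2)] X)
qed (use assms in \<open>simp_all add: hom_bimodule_simps\<close>)

text \<open>Balancedness governs the inner B, while \<open>l\<close> and \<open>r\<close> make the
  lift linear for the outer actions. It serves both the pairing \<alpha>(a) \<beta>(b) and the form
  \<alpha>(a b).\<close>

lemma tensor_lift_hom:
  assumes bal: "balanced_map \<B> Areg Areg A \<phi>"
    and l: "\<And>b x y. \<lbrakk>b \<in> B; x \<in> carrier A; y \<in> carrier A\<rbrakk> \<Longrightarrow> \<phi> (b \<otimes> x) y = b \<otimes> \<phi> x y"
    and r: "\<And>b x y. \<lbrakk>b \<in> B; x \<in> carrier A; y \<in> carrier A\<rbrakk> \<Longrightarrow> \<phi> x (y \<otimes> b) = \<phi> x y \<otimes> b"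
  shows "(\<lambda>X\<in>carrier AA. tensor_lift A \<phi> X) \<in> carrier H"
    and "\<lbrakk>x \<in> carrier A; y \<in> carrier A\<rbrakk> \<Longrightarrow> (\<lambda>X\<in>carrier AA. tensor_lift A \<phi> X) (ptensor x y) = \<phi> x y"
proof -
  note lift = AA.tensor_lift_closed[OF is_abelian_group bal] AA.tensor_lift_add[OF is_abelian_group bal]
  have pure: "tensor_lift A \<phi> (ptensor x y) = \<phi> x y" if "x \<in> carrier A" "y \<in> carrier A" for x y
    by (rule AA.tensor_lift_pure[OF is_abelian_group bal]) (use that in simp_all)
  have cl: "\<phi> x y \<in> carrier A" if "x \<in> carrier A" "y \<in> carrier A" for x y
    using bal that by (simp add: balanced_map_def)
  show "(\<lambda>X\<in>carrier AA. tensor_lift A \<phi> X) \<in> carrier H"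
  proof (rule hom_bimodule_restrictI[OF bimodule_AA_B])
    fix b X assume b: "b \<in> B" and X: "X \<in> carrier AA"
    show "tensor_lift A \<phi> (b \<odot>\<^bsub>AA\<^esub> X) = b \<otimes> tensor_lift A \<phi> X"
      using X by (induction rule: AA.tensor_induct)
        (use b in \<open>simp_all add: AA.smult_pure AA.tensor_smult_add AA.tensor_smult_closed B_carrier
          pure lift r_distr l\<close>)
    show "tensor_lift A \<phi> (X \<triangleleft>\<^bsub>AA\<^esub> b) = tensor_lift A \<phi> X \<otimes> b"
      using X by (induction rule: AA.tensor_induct)
        (use b in \<open>simp_all add: AA.rsmult_pure AA.tensor_rsmult_add AA.tensor_rsmult_closed B_carrier
          pure lift l_distr r\<close>)
  qed (simp_all add: lift)
  show "(\<lambda>X\<in>carrier AA. tensor_lift A \<phi> X) (ptensor x y) = \<phi> x y"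
    if "x \<in> carrier A" "y \<in> carrier A"
    using that by (simp add: pure)
qed

definition pairing :: "('a \<Rightarrow> 'a) \<Rightarrow> ('a \<Rightarrow> 'a) \<Rightarrow> ('a, 'a) tensor \<Rightarrow> 'a" where
  "pairing \<alpha> \<beta> = (\<lambda>X\<in>carrier AA. tensor_lift A (\<lambda>a a'. \<alpha> a \<otimes> \<beta> a') X)"

lemma pairing_hom:
  assumes "\<alpha> \<in> carrier S" "\<beta> \<in> carrier S"
  shows "pairing \<alpha> \<beta> \<in> carrier H"
    and "\<lbrakk>a \<in> carrier A; b \<in> carrier A\<rbrakk> \<Longrightarrow> pairing \<alpha> \<beta> (ptensor a b) = \<alpha> a \<otimes> \<beta> b"
proof -
  have bal: "balanced_map \<B> Areg Areg A (\<lambda>a a'. \<alpha> a \<otimes> \<beta> a')"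
    by (rule balanced_mapI)
      (simp_all add: S_hom[OF assms(1)] S_hom[OF assms(2)] l_distr r_distr m_assoc B_carrier)
  have l: "\<alpha> (b \<otimes> x) \<otimes> \<beta> y = b \<otimes> (\<alpha> x \<otimes> \<beta> y)" "\<alpha> x \<otimes> \<beta> (y \<otimes> b) = \<alpha> x \<otimes> \<beta> y \<otimes> b"
    if "b \<in> B" "x \<in> carrier A" "y \<in> carrier A" for b x y
    using that by (simp_all add: S_hom[OF assms(1)] S_hom[OF assms(2)] m_assoc B_carrier)
  show "pairing \<alpha> \<beta> \<in> carrier H"
    unfolding pairing_def by (rule tensor_lift_hom(1)[OF bal l])
  show "pairing \<alpha> \<beta> (ptensor a b) = \<alpha> a \<otimes> \<beta> b" if "a \<in> carrier A" "b \<in> carrier A"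
    unfolding pairing_def by (rule tensor_lift_hom(2)[OF bal l that])
qed

lemma H_apply:
  assumes "X \<in> carrier AA"
  shows "(f \<oplus>\<^bsub>H\<^esub> g) X = f X \<oplus> g X"
  using assms by (simp add: hom_bimodule_simps)

lemma pairing_balanced: "balanced_map \<R> S S H pairing"
  by (rule balanced_mapI)
    (auto intro!: H_eqI simp: pairing_hom H_apply S.M.a_closed H.M.a_closed S.smult_closed
      S.rsmult_closed S_apply S_hom l_distr r_distr m_assoc C_carrier)

lemma End_tensor_to_Hom_lift: "End_tensor_to_Hom A B = tensor_lift H pairing"
  by (simp add: End_tensor_to_Hom_def pairing_def[abs_def])

lemma End_tensor_to_Hom_closed: "X \<in> carrier SS \<Longrightarrow> End_tensor_to_Hom A B X \<in> carrier H"
  unfolding End_tensor_to_Hom_lift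
  by (rule SS.tensor_lift_closed[OF H.M.abelian_group_axioms pairing_balanced])

text \<open>On pure tensors the canonical map is the two-variable evaluation, so preimages under it
  can be recognised by their values.\<close>

lemma End_tensor_to_Hom_eval:
  assumes "X \<in> carrier SS" "a \<in> carrier A" "b \<in> carrier A"
  shows "End_tensor_to_Hom A B X (ptensor a b) = eval2 X a b"
  unfolding End_tensor_to_Hom_lift using assms(1)
  by (induction rule: SS.tensor_induct)
    (use assms(2-) in \<open>simp_all add: SS.tensor_lift_pure[OF H.M.abelian_group_axioms pairing_balanced]
      SS.tensor_lift_add[OF H.M.abelian_group_axioms pairing_balanced]
      pairing_hom eval2_pure eval2_add H_apply\<close>)

definition product_form :: "('a \<Rightarrow> 'a) \<Rightarrow> ('a, 'a) tensor \<Rightarrow> 'a" where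
  "product_form \<alpha> = (\<lambda>X\<in>carrier AA. tensor_lift A (\<lambda>a a'. \<alpha> (a \<otimes> a')) X)"

lemma product_form_hom:
  assumes "\<alpha> \<in> carrier S"
  shows "product_form \<alpha> \<in> carrier H"
    and "\<lbrakk>a \<in> carrier A; b \<in> carrier A\<rbrakk> \<Longrightarrow> product_form \<alpha> (ptensor a b) = \<alpha> (a \<otimes> b)"
proof -
  have bal: "balanced_map \<B> Areg Areg A (\<lambda>a a'. \<alpha> (a \<otimes> a'))"
    by (rule balanced_mapI) (simp_all add: S_hom[OF assms] l_distr r_distr m_assoc B_carrier)
  have l: "\<alpha> ((b \<otimes> x) \<otimes> y) = b \<otimes> \<alpha> (x \<otimes> y)" "\<alpha> (x \<otimes> (y \<otimes> b)) = \<alpha> (x \<otimes> y) \<otimes> b"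
    if "b \<in> B" "x \<in> carrier A" "y \<in> carrier A" for b x y
    using that S_hom(3)[OF assms, of b "x \<otimes> y"] S_hom(4)[OF assms, of "x \<otimes> y" b]
    by (simp_all add: m_assoc B_carrier)
  show "product_form \<alpha> \<in> carrier H"
    unfolding product_form_def by (rule tensor_lift_hom(1)[OF bal l])
  show "product_form \<alpha> (ptensor a b) = \<alpha> (a \<otimes> b)" if "a \<in> carrier A" "b \<in> carrier A"
    unfolding product_form_def by (rule tensor_lift_hom(2)[OF bal l that])
qed

lemma comult_inv_into: "comult S \<alpha> = inv_into (carrier SS) (End_tensor_to_Hom A B) (product_form \<alpha>)"
  by (simp add: comult_End_coring product_form_def)

end

section \<open>Expansions with respect to a quasi-basis\<close>

locale quasi_basis_extension = ring_extension +
  fixes n :: nat and \<gamma> :: "nat \<Rightarrow> 'a \<Rightarrow> 'a" and u :: "nat \<Rightarrow> ('a, 'a) tensor"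
  assumes \<gamma>_closed: "j < n \<Longrightarrow> \<gamma> j \<in> carrier S"
    and u_closed: "j < n \<Longrightarrow> u j \<in> carrier AA"
    and u_central: "\<lbrakk>j < n; b \<in> B\<rbrakk> \<Longrightarrow> b \<odot>\<^bsub>AA\<^esub> u j = u j \<triangleleft>\<^bsub>AA\<^esub> b"
    and quasi_basis: "a \<in> carrier A \<Longrightarrow> ptensor \<one> a = (\<Oplus>\<^bsub>AA\<^esub>j\<in>{..<n}. \<gamma> j a \<odot>\<^bsub>AA\<^esub> u j)"
begin

text \<open>Contract the quasi-basis identity with \<phi>: the left side becomes \<phi>(a), and on
  the right the coefficients \<gamma>_j(a) come out by left A-linearity of the contraction.\<close>

lemma left_linear_expansion:
  assumes \<phi>: "left_linear \<phi>" and a: "a \<in> carrier A"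
  shows "\<phi> a = (\<Oplus>j\<in>{..<n}. \<gamma> j a \<otimes> contract \<phi> (u j))"
proof -
  have c: "\<gamma> j a \<in> carrier A" if "j < n" for j using S_hom(1)[OF \<gamma>_closed[OF that] a] .
  have "\<phi> a = contract \<phi> (ptensor \<one> a)"
    using a by (simp add: contract_pure[OF \<phi>] left_linearD[OF \<phi>])
  also have "\<dots> = (\<Oplus>j\<in>{..<n}. contract \<phi> (\<gamma> j a \<odot>\<^bsub>AA\<^esub> u j))"
    unfolding quasi_basis[OF a]
    by (rule hom_finsum[OF AA.abelian_group_tensor])
      (simp_all add: contract_closed[OF \<phi>] contract_add[OF \<phi>] AA.tensor_smult_closed c u_closed Pi_iff)
  also have "\<dots> = (\<Oplus>j\<in>{..<n}. \<gamma> j a \<otimes> contract \<phi> (u j))"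
    by (rule finsum_cong') (simp_all add: contract_smult[OF \<phi>] contract_closed[OF \<phi>] c u_closed Pi_iff)
  finally show ?thesis .
qed

text \<open>Right B-linearity of \<alpha> moves b into its argument, that is, to the right of u_j.
  Centrality of u_j carries b to the left, where it leaves the contraction.\<close>

lemma coefficient_closed:
  assumes \<alpha>: "\<alpha> \<in> carrier S" and j: "j < n"
  shows "contract \<alpha> (u j) \<in> C"
proof -
  note l = S_left_linear[OF \<alpha>]
  have "contract \<alpha> (u j) \<otimes> b = b \<otimes> contract \<alpha> (u j)" if b: "b \<in> B" for b
  proof -
    have lb: "left_linear (\<lambda>x. \<alpha> x \<otimes> b)"
      by (rule left_linearI) (use b in \<open>simp_all add: S_hom[OF \<alpha>] B_carrier l_distr m_assoc\<close>)
    have "contract \<alpha> (u j) \<otimes> b = contract (\<lambda>x. \<alpha> x \<otimes> b) (u j)"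
      by (rule contract_mult_right[symmetric, OF l lb]) (simp_all add: b B_carrier u_closed j)
    also have "\<dots> = contract \<alpha> (u j \<triangleleft>\<^bsub>AA\<^esub> b)"
      by (rule contract_rsmult[OF l lb]) (simp_all add: b B_carrier u_closed j S_hom[OF \<alpha>])
    also have "\<dots> = b \<otimes> contract \<alpha> (u j)"
      unfolding u_central[OF j b, symmetric]
      by (rule contract_smult[OF l]) (simp_all add: b B_carrier u_closed j)
    finally show ?thesis .
  qed
  then show ?thesis using contract_closed[OF l u_closed[OF j]] by (simp add: centralizer_def)
qed

text \<open>Because the coefficients lie in R, the pointwise expansion of \<alpha> is an equation in
  the right R-module S.\<close>

lemma dual_basis:
  assumes \<alpha>: "\<alpha> \<in> carrier S"
  shows "\<alpha> = (\<Oplus>\<^bsub>S\<^esub>j\<in>{..<n}. \<gamma> j \<triangleleft>\<^bsub>S\<^esub> contract \<alpha> (u j))"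
proof (rule S_eqI[OF \<alpha>])
  have t: "\<gamma> j \<triangleleft>\<^bsub>S\<^esub> contract \<alpha> (u j) \<in> carrier S" if "j < n" for j
    using S.rsmult_closed[OF \<gamma>_closed[OF that]] coefficient_closed[OF \<alpha> that] by simp
  then show "(\<Oplus>\<^bsub>S\<^esub>j\<in>{..<n}. \<gamma> j \<triangleleft>\<^bsub>S\<^esub> contract \<alpha> (u j)) \<in> carrier S"
    by (intro S.M.finsum_closed) simp
  fix a assume a: "a \<in> carrier A"
  have "(\<Oplus>\<^bsub>S\<^esub>j\<in>{..<n}. \<gamma> j \<triangleleft>\<^bsub>S\<^esub> contract \<alpha> (u j)) a =
      (\<Oplus>j\<in>{..<n}. (\<gamma> j \<triangleleft>\<^bsub>S\<^esub> contract \<alpha> (u j)) a)"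
    by (rule hom_finsum[OF S.M.abelian_group_axioms, where f = "\<lambda>\<alpha>. \<alpha> a"])
      (simp_all add: a t S_hom S_apply Pi_iff)
  also have "\<dots> = \<alpha> a"
    using left_linear_expansion[OF S_left_linear[OF \<alpha>] a] by (simp add: S_apply a)
  finally show "\<alpha> a = (\<Oplus>\<^bsub>S\<^esub>j\<in>{..<n}. \<gamma> j \<triangleleft>\<^bsub>S\<^esub> contract \<alpha> (u j)) a" by simp
qed

section \<open>Tensors over R are determined by their values\<close>

context
  fixes N :: "('a, 'n, 'a, 'z) bimodule_scheme"
  assumes N: "bimodule \<R> \<R> N"
begin

interpretation N: bimodule \<R> \<R> N by (rule N)

interpretation SN: bimodule_pair \<R> \<R> \<R> S N
  by (intro bimodule_pair.intro bimodule_S N)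

text \<open>The j-th dual-basis functional applied to the first factor, followed by the left action
  of R on N.\<close>

private abbreviation (input) component where
  "component j \<equiv> tensor_lift N (\<lambda>\<alpha> y. contract \<alpha> (u j) \<odot>\<^bsub>N\<^esub> y)"

private lemma component_balanced:
  assumes j: "j < n"
  shows "balanced_map \<R> S N N (\<lambda>\<alpha> y. contract \<alpha> (u j) \<odot>\<^bsub>N\<^esub> y)"
proof (rule balanced_mapI)
  fix \<alpha> \<beta> y assume ab: "\<alpha> \<in> carrier S" "\<beta> \<in> carrier S" and y: "y \<in> carrier N"
  have "contract (\<alpha> \<oplus>\<^bsub>S\<^esub> \<beta>) (u j) = contract \<alpha> (u j) \<oplus> contract \<beta> (u j)"
    by (rule contract_plus) (use ab j in \<open>simp_all add: S_left_linear S_apply u_closed\<close>)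
  then show "contract (\<alpha> \<oplus>\<^bsub>S\<^esub> \<beta>) (u j) \<odot>\<^bsub>N\<^esub> y = contract \<alpha> (u j) \<odot>\<^bsub>N\<^esub> y \<oplus>\<^bsub>N\<^esub> contract \<beta> (u j) \<odot>\<^bsub>N\<^esub> y"
    using N.smult_l_distr[of "contract \<alpha> (u j)" "contract \<beta> (u j)" y] ab y j
    by (simp add: coefficient_closed)
next
  fix \<alpha> r y assume \<alpha>: "\<alpha> \<in> carrier S" and r: "r \<in> carrier \<R>" and y: "y \<in> carrier N"
  have "contract (\<alpha> \<triangleleft>\<^bsub>S\<^esub> r) (u j) = contract \<alpha> (u j) \<otimes> r"
    by (rule contract_mult_right)
      (use \<alpha> r j in \<open>simp_all add: S_left_linear S.rsmult_closed S_apply u_closed C_carrier\<close>)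
  then show "contract (\<alpha> \<triangleleft>\<^bsub>S\<^esub> r) (u j) \<odot>\<^bsub>N\<^esub> y = contract \<alpha> (u j) \<odot>\<^bsub>N\<^esub> (r \<odot>\<^bsub>N\<^esub> y)"
    using N.smult_assoc[of "contract \<alpha> (u j)" r y] \<alpha> r y j by (simp add: coefficient_closed)
qed (use j in \<open>simp_all add: coefficient_closed N.smult_closed N.smult_r_distr\<close>)

private lemmas component_closed = SN.tensor_lift_closed[OF N.M.abelian_group_axioms component_balanced]
private lemmas component_pure = SN.tensor_lift_pure[OF N.M.abelian_group_axioms component_balanced]
private lemmas component_add = SN.tensor_lift_add[OF N.M.abelian_group_axioms component_balanced]

text \<open>For a pure tensor, expand the first factor in the dual basis and pass the coefficients
  across the tensor sign.\<close>

private lemma component_decomposition: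
  assumes "X \<in> carrier SN.MN"
  shows "X = (\<Oplus>\<^bsub>SN.MN\<^esub>j\<in>{..<n}. SN.pure (\<gamma> j) (component j X))"
  using assms
proof (induction rule: SN.tensor_induct)
  case (pure \<alpha> y)
  have cl: "\<gamma> j \<triangleleft>\<^bsub>S\<^esub> contract \<alpha> (u j) \<in> carrier S" "contract \<alpha> (u j) \<odot>\<^bsub>N\<^esub> y \<in> carrier N" if "j < n" for j
    using S.rsmult_closed[OF \<gamma>_closed[OF that]] N.smult_closed[of "contract \<alpha> (u j)" y]
      coefficient_closed[OF pure(1) that] pure(2) by simp_all
  have "SN.pure \<alpha> y = SN.pure (\<Oplus>\<^bsub>S\<^esub>j\<in>{..<n}. \<gamma> j \<triangleleft>\<^bsub>S\<^esub> contract \<alpha> (u j)) y"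
    using dual_basis[OF pure(1)] by simp
  also have "\<dots> = (\<Oplus>\<^bsub>SN.MN\<^esub>j\<in>{..<n}. SN.pure (\<gamma> j \<triangleleft>\<^bsub>S\<^esub> contract \<alpha> (u j)) y)"
    by (rule SN.T.hom_finsum[OF S.M.abelian_group_axioms, where f = "\<lambda>\<alpha>. SN.pure \<alpha> y"])
      (simp_all add: pure cl SN.pure_add_left Pi_iff)
  also have "\<dots> = (\<Oplus>\<^bsub>SN.MN\<^esub>j\<in>{..<n}. SN.pure (\<gamma> j) (component j (SN.pure \<alpha> y)))"
    by (rule SN.T.finsum_cong')
      (simp_all add: pure cl component_pure \<gamma>_closed SN.pure_balanced coefficient_closed Pi_iff)
  finally show ?case .
next
  case (add X Y)
  have "X \<oplus>\<^bsub>SN.MN\<^esub> Y = (\<Oplus>\<^bsub>SN.MN\<^esub>j\<in>{..<n}. SN.pure (\<gamma> j) (component j X)) \<oplus>\<^bsub>SN.MN\<^esub>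
      (\<Oplus>\<^bsub>SN.MN\<^esub>j\<in>{..<n}. SN.pure (\<gamma> j) (component j Y))"
    using add.IH by simp
  also have "\<dots> = (\<Oplus>\<^bsub>SN.MN\<^esub>j\<in>{..<n}. SN.pure (\<gamma> j) (component j X) \<oplus>\<^bsub>SN.MN\<^esub> SN.pure (\<gamma> j) (component j Y))"
    by (rule SN.T.finsum_addf[symmetric]) (simp_all add: Pi_iff component_closed \<gamma>_closed add.hyps)
  also have "\<dots> = (\<Oplus>\<^bsub>SN.MN\<^esub>j\<in>{..<n}. SN.pure (\<gamma> j) (component j (X \<oplus>\<^bsub>SN.MN\<^esub> Y)))"
    by (rule SN.T.finsum_cong')
      (simp_all add: Pi_iff component_closed component_add \<gamma>_closed add.hyps SN.pure_add_right)
  finally show ?case .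
qed

text \<open>On a pure tensor both sides are the coefficient of \<alpha> times e(y). Thus e of a
  component can be computed from the values of the tensor.\<close>

private lemma component_eval:
  assumes e: "linear_form N e" and "X \<in> carrier SN.MN" and j: "j < n"
  shows "e (component j X) = contract (tensor_eval e X) (u j)"
  using assms(2)
proof (induction rule: SN.tensor_induct)
  case (pure \<alpha> y)
  have "contract (tensor_eval e (SN.pure \<alpha> y)) (u j) = contract \<alpha> (u j) \<otimes> e y"
    by (rule contract_mult_right)
      (simp_all add: pure S_left_linear tensor_eval_left_linear[OF N e] tensor_eval_pure[OF N e]
        linear_formD[OF e] u_closed j)
  then show ?case
    using pure j by (simp add: component_pure linear_formD[OF e] coefficient_closed)
next
  case (add X Y)
  have "contract (tensor_eval e (X \<oplus>\<^bsub>SN.MN\<^esub> Y)) (u j) =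
      contract (tensor_eval e X) (u j) \<oplus> contract (tensor_eval e Y) (u j)"
    by (rule contract_plus)
      (simp_all add: add.hyps tensor_eval_left_linear[OF N e] tensor_eval_add[OF N e] u_closed j)
  then show ?case
    using add j by (simp add: component_add component_closed linear_formD[OF e])
qed

text \<open>Equal values give equal contractions with u_j, hence equal e-values of all components.
  Since E separates the points of N, the components agree, and they determine the tensor.\<close>

lemma tensor_eval_inject:
  assumes e: "\<And>e. e \<in> E \<Longrightarrow> linear_form N e"
    and sep: "\<And>x y. \<lbrakk>x \<in> carrier N; y \<in> carrier N; \<And>e. e \<in> E \<Longrightarrow> e x = e y\<rbrakk> \<Longrightarrow> x = y"
    and X: "X \<in> carrier SN.MN" and Y: "Y \<in> carrier SN.MN"
    and eq: "\<And>e a. \<lbrakk>e \<in> E; a \<in> carrier A\<rbrakk> \<Longrightarrow> tensor_eval e X a = tensor_eval e Y a"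
  shows "X = Y"
proof -
  have "component j X = component j Y" if j: "j < n" for j
  proof (rule sep)
    fix e assume "e \<in> E"
    note e = e[OF this] and eq = eq[OF this]
    show "e (component j X) = e (component j Y)"
      unfolding component_eval[OF e X j] component_eval[OF e Y j]
      by (rule contract_eqI) (simp_all add: tensor_eval_left_linear[OF N e] X Y eq u_closed j)
  qed (simp_all add: component_closed X Y j)
  then have "(\<Oplus>\<^bsub>SN.MN\<^esub>j\<in>{..<n}. SN.pure (\<gamma> j) (component j X)) =
      (\<Oplus>\<^bsub>SN.MN\<^esub>j\<in>{..<n}. SN.pure (\<gamma> j) (component j Y))"
    by (intro SN.T.finsum_cong') (simp_all add: Pi_iff component_closed \<gamma>_closed Y)
  then show ?thesis using component_decomposition[OF X] component_decomposition[OF Y] by simp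
qed

end

lemma eval2_inject:
  assumes "X \<in> carrier SS" "Y \<in> carrier SS"
    and "\<And>a b. \<lbrakk>a \<in> carrier A; b \<in> carrier A\<rbrakk> \<Longrightarrow> eval2 X a b = eval2 Y a b"
  shows "X = Y"
proof (rule tensor_eval_inject[OF bimodule_S, of "(\<lambda>b \<beta>. \<beta> b) ` carrier A"])
  fix \<alpha> \<beta> assume "\<alpha> \<in> carrier S" "\<beta> \<in> carrier S" "\<And>e. e \<in> (\<lambda>b \<beta>. \<beta> b) ` carrier A \<Longrightarrow> e \<alpha> = e \<beta>"
  then show "\<alpha> = \<beta>" by (intro S_eqI) blast+
qed (use assms in \<open>auto simp: linear_form_S\<close>)

text \<open>A second use of the separation principle: by \<open>eval2_inject\<close>, the
  two-variable evaluations separate the points of S \<otimes> S.\<close>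

lemma eval3_inject:
  assumes "X \<in> carrier SSS" "Y \<in> carrier SSS"
    and "\<And>a b c. \<lbrakk>a \<in> carrier A; b \<in> carrier A; c \<in> carrier A\<rbrakk> \<Longrightarrow> eval3 X a b c = eval3 Y a b c"
  shows "X = Y"
proof (rule tensor_eval_inject[OF SS.bimodule_tensor, of "(\<lambda>(b, c) Z. eval2 Z b c) ` (carrier A \<times> carrier A)"])
  fix Z W assume ZW: "Z \<in> carrier SS" "W \<in> carrier SS"
    and eq: "\<And>e. e \<in> (\<lambda>(b, c) Z. eval2 Z b c) ` (carrier A \<times> carrier A) \<Longrightarrow> e Z = e W"
  show "Z = W"
  proof (rule eval2_inject[OF ZW])
    fix a b assume "a \<in> carrier A" "b \<in> carrier A"
    then show "eval2 Z a b = eval2 W a b" using eq[of "\<lambda>Z. eval2 Z a b"] by force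
  qed
qed (use assms in \<open>auto simp: eval2_linear_form\<close>)

text \<open>The preimage is the sum of the \<gamma>_j \<otimes> \<delta>_j, where \<delta>_j(b)
  contracts u_j with the map y to f(y \<otimes> b). Expanding that left linear map at a recovers f(a
  \<otimes> b).\<close>

lemma Hom_preimage:
  assumes f: "f \<in> carrier H"
  shows "\<exists>X\<in>carrier SS. End_tensor_to_Hom A B X = f"
proof -
  note f' = hom_bimoduleD[OF f]
  have l: "left_linear (\<lambda>y. f (ptensor y b))" if "b \<in> carrier A" for b
  proof (rule left_linearI)
    fix x y assume "x \<in> carrier A" "y \<in> carrier A"
    then show "f (ptensor (x \<oplus> y) b) = f (ptensor x b) \<oplus> f (ptensor y b)"
      using AA.pure_add_left[of x y b] f'(2)[of "ptensor x b" "ptensor y b"] that by simp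
  next
    fix c x assume "c \<in> B" "x \<in> carrier A"
    then show "f (ptensor (c \<otimes> x) b) = c \<otimes> f (ptensor x b)"
      using AA.smult_pure[of c x b] f'(3)[of c "ptensor x b"] that B_carrier by simp
  qed (simp add: f' that)
  define \<delta> where "\<delta> j = (\<lambda>b\<in>carrier A. contract (\<lambda>y. f (ptensor y b)) (u j))" for j
  have \<delta>: "\<delta> j \<in> carrier S" if j: "j < n" for j
    unfolding \<delta>_def
  proof (rule S_restrictI)
    fix x assume x: "x \<in> carrier A"
    show "contract (\<lambda>y. f (ptensor y x)) (u j) \<in> carrier A"
      by (rule contract_closed[OF l[OF x] u_closed[OF j]])
    show "contract (\<lambda>z. f (ptensor z (x \<oplus> y))) (u j) =
        contract (\<lambda>z. f (ptensor z x)) (u j) \<oplus> contract (\<lambda>z. f (ptensor z y)) (u j)"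
      if y: "y \<in> carrier A" for y
    proof (rule contract_plus)
      fix z assume "z \<in> carrier A"
      then show "f (ptensor z (x \<oplus> y)) = f (ptensor z x) \<oplus> f (ptensor z y)"
        using AA.pure_add_right[of z x y] f'(2)[of "ptensor z x" "ptensor z y"] x y by simp
    qed (simp_all add: l x y u_closed j)
  next
    fix b x assume b: "b \<in> B" and x: "x \<in> carrier A"
    \<comment> \<open>Since y \<otimes> b x = y b \<otimes> x, left linearity of \<delta>_j in its
      own variable turns into a right multiplication in y, which centrality of u_j resolves.\<close>
    have "contract (\<lambda>y. f (ptensor y (b \<otimes> x))) (u j) = contract (\<lambda>y. f (ptensor y x)) (u j \<triangleleft>\<^bsub>AA\<^esub> b)"
      by (rule contract_rsmult)
        (use AA.pure_balanced[of _ b x] in \<open>simp_all add: l x b B_carrier u_closed j\<close>)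
    also have "\<dots> = b \<otimes> contract (\<lambda>y. f (ptensor y x)) (u j)"
      unfolding u_central[OF j b, symmetric]
      by (rule contract_smult[OF l[OF x] B_carrier[OF b] u_closed[OF j]])
    finally show "contract (\<lambda>y. f (ptensor y (b \<otimes> x))) (u j) = b \<otimes> contract (\<lambda>y. f (ptensor y x)) (u j)" .
    show "contract (\<lambda>y. f (ptensor y (x \<otimes> b))) (u j) = contract (\<lambda>y. f (ptensor y x)) (u j) \<otimes> b"
    proof (rule contract_mult_right)
      fix y assume "y \<in> carrier A"
      then show "f (ptensor y (x \<otimes> b)) = f (ptensor y x) \<otimes> b"
        using AA.rsmult_pure[of b y x] f'(4)[of "ptensor y x" b] x b B_carrier by simp
    qed (simp_all add: l x b B_carrier u_closed j)
  qed
  define X where "X = (\<Oplus>\<^bsub>SS\<^esub>j\<in>{..<n}. SS.pure (\<gamma> j) (\<delta> j))"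
  have X: "X \<in> carrier SS"
    unfolding X_def by (intro SS.T.finsum_closed) (simp add: \<gamma>_closed \<delta> Pi_iff)
  have "End_tensor_to_Hom A B X = f"
  proof (rule H_eqI[OF End_tensor_to_Hom_closed[OF X] f])
    fix a b assume a: "a \<in> carrier A" and b: "b \<in> carrier A"
    have "eval2 X a b = (\<Oplus>j\<in>{..<n}. eval2 (SS.pure (\<gamma> j) (\<delta> j)) a b)"
      unfolding X_def
      by (rule hom_finsum[OF SS.abelian_group_tensor, where f = "\<lambda>X. eval2 X a b"])
        (simp_all add: eval2_closed eval2_add a b \<gamma>_closed \<delta> Pi_iff)
    also have "\<dots> = (\<Oplus>j\<in>{..<n}. \<gamma> j a \<otimes> contract (\<lambda>y. f (ptensor y b)) (u j))"
      by (rule finsum_cong')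
        (simp_all add: eval2_pure a b \<gamma>_closed \<delta> Pi_iff S_hom contract_closed[OF l[OF b]] u_closed,
          simp add: \<delta>_def b)
    also have "\<dots> = f (ptensor a b)" using left_linear_expansion[OF l[OF b] a] by simp
    finally show "End_tensor_to_Hom A B X (ptensor a b) = f (ptensor a b)"
      by (simp add: End_tensor_to_Hom_eval X a b)
  qed
  with X show ?thesis by blast
qed

text \<open>Surjectivity guarantees that \<open>inv_into\<close> returns a genuine preimage. The
  coproduct is handled below through its closure and this value formula, which pins it down by
  \<open>eval2_inject\<close>.\<close>

lemma
  assumes "\<alpha> \<in> carrier S"
  shows comult_closed: "comult S \<alpha> \<in> carrier SS"
    and comult_eval: "\<lbrakk>a \<in> carrier A; b \<in> carrier A\<rbrakk> \<Longrightarrow> eval2 (comult S \<alpha>) a b = \<alpha> (a \<otimes> b)"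
proof -
  have im: "product_form \<alpha> \<in> End_tensor_to_Hom A B ` carrier SS"
    using Hom_preimage[OF product_form_hom(1)[OF assms]] by (metis imageI)
  show c: "comult S \<alpha> \<in> carrier SS"
    unfolding comult_inv_into by (rule inv_into_into[OF im])
  have "End_tensor_to_Hom A B (comult S \<alpha>) = product_form \<alpha>"
    unfolding comult_inv_into by (rule f_inv_into_f[OF im])
  then show "eval2 (comult S \<alpha>) a b = \<alpha> (a \<otimes> b)" if "a \<in> carrier A" "b \<in> carrier A"
    using End_tensor_to_Hom_eval[OF c that] product_form_hom(2)[OF assms that] by simp
qed


subsection \<open>The coring axioms\<close>

lemma comult_bimodule_hom: "comult S \<in> bimodule_hom \<R> \<R> S SS"
proof (rule bimodule_homI)
  fix \<alpha> \<beta> assume "\<alpha> \<in> carrier S" "\<beta> \<in> carrier S"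
  then show "comult S (\<alpha> \<oplus>\<^bsub>S\<^esub> \<beta>) = comult S \<alpha> \<oplus>\<^bsub>SS\<^esub> comult S \<beta>"
    by (intro eval2_inject) (simp_all add: comult_closed comult_eval eval2_add S_apply)
next
  fix r \<alpha> assume "r \<in> carrier \<R>" "\<alpha> \<in> carrier S"
  then show "comult S (r \<odot>\<^bsub>S\<^esub> \<alpha>) = r \<odot>\<^bsub>SS\<^esub> comult S \<alpha>"
    by (intro eval2_inject) (simp_all add: comult_closed comult_eval S.smult_closed
        SS.tensor_smult_closed linear_formD(3)[OF eval2_linear_form] S_apply)
next
  fix r \<alpha> assume "\<alpha> \<in> carrier S" "r \<in> carrier \<R>"
  then show "comult S (\<alpha> \<triangleleft>\<^bsub>S\<^esub> r) = comult S \<alpha> \<triangleleft>\<^bsub>SS\<^esub> r"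
    by (intro eval2_inject) (simp_all add: comult_closed comult_eval S.rsmult_closed
        SS.tensor_rsmult_closed eval2_rsmult S_apply)
qed (rule comult_closed)

lemmas comult_hom = bimodule_homD[OF comult_bimodule_hom]

lemma counit_bimodule_hom: "counit S \<in> bimodule_hom \<R> \<R> S (regular_bimodule \<R>)"
  by (rule bimodule_homI) (simp_all add: End_coring_simps(6) S_one S_apply)

text \<open>Applying the counit to the first leg is evaluation of the first variable at 1, which for
  the coproduct gives \<alpha>(1 a).\<close>

lemma counit_left:
  assumes "\<alpha> \<in> carrier S"
  shows "tensor_lift S (\<lambda>x y. counit S x \<odot>\<^bsub>S\<^esub> y) (comult S \<alpha>) = \<alpha>"
proof -
  let ?l = "tensor_lift S (\<lambda>x y. x \<one> \<odot>\<^bsub>S\<^esub> y)"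
  have bal: "balanced_map \<R> S S S (\<lambda>x y. x \<one> \<odot>\<^bsub>S\<^esub> y)"
    using bimodule_homD[OF counit_bimodule_hom, unfolded End_coring_simps(6)] S.smult_l_distr S.smult_assoc
    by (intro balanced_mapI) (simp_all add: S.smult_closed S.smult_r_distr)
  note lift = SS.tensor_lift_closed[OF S.M.abelian_group_axioms bal]
    SS.tensor_lift_add[OF S.M.abelian_group_axioms bal] SS.tensor_lift_pure[OF S.M.abelian_group_axioms bal]
  have "?l X a = eval2 X \<one> a" if "X \<in> carrier SS" "a \<in> carrier A" for X a
    using that(1) by (induction rule: SS.tensor_induct)
      (use that(2) in \<open>simp_all add: lift S_apply eval2_pure eval2_add\<close>)
  then show ?thesis
    unfolding End_coring_simps(6)
    by (intro S_eqI) (simp_all add: lift comult_closed comult_eval assms)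
qed

text \<open>Here the second variable is set to 1, and the coproduct gives \<alpha>(a 1).\<close>

lemma counit_right:
  assumes "\<alpha> \<in> carrier S"
  shows "tensor_lift S (\<lambda>x y. x \<triangleleft>\<^bsub>S\<^esub> counit S y) (comult S \<alpha>) = \<alpha>"
proof -
  let ?l = "tensor_lift S (\<lambda>x y. x \<triangleleft>\<^bsub>S\<^esub> y \<one>)"
  have bal: "balanced_map \<R> S S S (\<lambda>x y. x \<triangleleft>\<^bsub>S\<^esub> y \<one>)"
    using bimodule_homD[OF counit_bimodule_hom, unfolded End_coring_simps(6)] S.rsmult_r_distr S.rsmult_assoc
    by (intro balanced_mapI) (simp_all add: S.rsmult_closed S.rsmult_l_distr)
  note lift = SS.tensor_lift_closed[OF S.M.abelian_group_axioms bal]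
    SS.tensor_lift_add[OF S.M.abelian_group_axioms bal] SS.tensor_lift_pure[OF S.M.abelian_group_axioms bal]
  have "?l X a = eval2 X a \<one>" if "X \<in> carrier SS" "a \<in> carrier A" for X a
    using that(1) by (induction rule: SS.tensor_induct)
      (use that(2) in \<open>simp_all add: lift S_apply eval2_pure eval2_add\<close>)
  then show ?thesis
    unfolding End_coring_simps(6)
    by (intro S_eqI) (simp_all add: lift comult_closed comult_eval assms)
qed

section \<open>Coassociativity\<close>

interpretation SS_S: bimodule_pair \<R> \<R> \<R> SS S
  by (intro bimodule_pair.intro SS.bimodule_tensor bimodule_S)

abbreviation SS_S where "SS_S \<equiv> tensor_product \<R> SS S"

text \<open>The inner lift of \<open>tensor_assoc\<close> with the third factor z held fixed; the
  associator is then the lift of this family over X and z.\<close>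

definition assoc_left :: "('a \<Rightarrow> 'a) \<Rightarrow> ('a \<Rightarrow> 'a, 'a \<Rightarrow> 'a) tensor \<Rightarrow>
    ('a \<Rightarrow> 'a, ('a \<Rightarrow> 'a, 'a \<Rightarrow> 'a) tensor) tensor" where
  "assoc_left z = tensor_lift SSS (\<lambda>x y. SSS.pure x (SS.pure y z))"

lemma assoc_left_balanced:
  "z \<in> carrier S \<Longrightarrow> balanced_map \<R> S S SSS (\<lambda>x y. SSS.pure x (SS.pure y z))"
  by (rule balanced_mapI)
    (simp_all add: SSS.pure_add_left SSS.pure_add_right SS.pure_add_left SSS.pure_balanced SS.smult_pure)

lemmas assoc_left_closed = SSS.T.abelian_group_axioms[THEN SS.tensor_lift_closed,
    OF assoc_left_balanced, folded assoc_left_def]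
lemmas assoc_left_add = SSS.T.abelian_group_axioms[THEN SS.tensor_lift_add,
    OF assoc_left_balanced, folded assoc_left_def]
lemmas assoc_left_pure = SSS.T.abelian_group_axioms[THEN SS.tensor_lift_pure,
    OF assoc_left_balanced, folded assoc_left_def]

text \<open>Balancing in the outer tensor product reduces to balancing inside the right-hand pair: y
  r \<otimes> z = y \<otimes> r z.\<close>

lemma assoc_balanced: "balanced_map \<R> SS S SSS (\<lambda>X z. assoc_left z X)"
proof (rule balanced_mapI)
  fix X z z' assume X: "X \<in> carrier SS" and z: "z \<in> carrier S" "z' \<in> carrier S"
  show "assoc_left (z \<oplus>\<^bsub>S\<^esub> z') X = assoc_left z X \<oplus>\<^bsub>SSS\<^esub> assoc_left z' X"
    using X by (induction rule: SS.tensor_induct)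
      (use z in \<open>simp_all add: assoc_left_pure assoc_left_add assoc_left_closed SS.pure_add_right
        SSS.pure_add_right SSS.T.a_ac\<close>)
next
  fix X r z assume X: "X \<in> carrier SS" and r: "r \<in> carrier \<R>" and z: "z \<in> carrier S"
  show "assoc_left z (X \<triangleleft>\<^bsub>SS\<^esub> r) = assoc_left (r \<odot>\<^bsub>S\<^esub> z) X"
    using X by (induction rule: SS.tensor_induct)
      (use r z in \<open>simp_all add: assoc_left_pure assoc_left_add S.smult_closed S.rsmult_closed SS.rsmult_pure
        SS.tensor_rsmult_add SS.tensor_rsmult_closed SS.pure_balanced\<close>)
qed (simp_all add: assoc_left_closed assoc_left_add)

lemma tensor_assoc_lift: "tensor_assoc \<R> \<R> S S S = tensor_lift SSS (\<lambda>X z. assoc_left z X)"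
  by (simp add: tensor_assoc_def assoc_left_def Let_def)

lemmas assoc_closed = SS_S.tensor_lift_closed[OF SSS.T.abelian_group_axioms assoc_balanced, folded tensor_assoc_lift]
lemmas assoc_add = SS_S.tensor_lift_add[OF SSS.T.abelian_group_axioms assoc_balanced, folded tensor_assoc_lift]
lemmas assoc_pure = SS_S.tensor_lift_pure[OF SSS.T.abelian_group_axioms assoc_balanced, folded tensor_assoc_lift]

lemma assoc_left_eval:
  assumes "X \<in> carrier SS" "z \<in> carrier S" "a \<in> carrier A" "b \<in> carrier A" "c \<in> carrier A"
  shows "eval3 (assoc_left z X) a b c = eval2 X a b \<otimes> z c"
  using assms(1) by (induction rule: SS.tensor_induct)
    (use assms(2-) in \<open>simp_all add: assoc_left_pure assoc_left_add assoc_left_closed eval3_pure eval3_add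
      eval2_pure eval2_add eval2_closed S_hom m_assoc l_distr\<close>)

definition comult_id :: "('a \<Rightarrow> 'a, 'a \<Rightarrow> 'a) tensor \<Rightarrow> (('a \<Rightarrow> 'a, 'a \<Rightarrow> 'a) tensor, 'a \<Rightarrow> 'a) tensor" where
  "comult_id = tensor_lift SS_S (\<lambda>x y. SS_S.pure (comult S x) y)"

definition id_comult :: "('a \<Rightarrow> 'a, 'a \<Rightarrow> 'a) tensor \<Rightarrow> ('a \<Rightarrow> 'a, ('a \<Rightarrow> 'a, 'a \<Rightarrow> 'a) tensor) tensor" where
  "id_comult = tensor_lift SSS (\<lambda>x y. SSS.pure x (comult S y))"

lemma tensor_map_comult:
  "tensor_map \<R> SS S (comult S) id = comult_id" "tensor_map \<R> S SS id (comult S) = id_comult"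
  by (simp_all add: tensor_map_def comult_id_def id_comult_def)

lemma comult_id_balanced: "balanced_map \<R> S S SS_S (\<lambda>x y. SS_S.pure (comult S x) y)"
  by (rule balanced_mapI)
    (simp_all add: comult_hom SS_S.pure_add_left SS_S.pure_add_right SS_S.pure_balanced)

lemma id_comult_balanced: "balanced_map \<R> S S SSS (\<lambda>x y. SSS.pure x (comult S y))"
  by (rule balanced_mapI)
    (simp_all add: comult_hom SSS.pure_add_left SSS.pure_add_right SSS.pure_balanced)

lemmas comult_id_lift = SS_S.T.abelian_group_axioms comult_id_balanced
lemmas comult_id_closed = SS.tensor_lift_closed[OF comult_id_lift, folded comult_id_def]
lemmas comult_id_add = SS.tensor_lift_add[OF comult_id_lift, folded comult_id_def]
lemmas comult_id_pure = SS.tensor_lift_pure[OF comult_id_lift, folded comult_id_def]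

lemmas id_comult_lift = SSS.T.abelian_group_axioms id_comult_balanced
lemmas id_comult_closed = SS.tensor_lift_closed[OF id_comult_lift, folded id_comult_def]
lemmas id_comult_add = SS.tensor_lift_add[OF id_comult_lift, folded id_comult_def]
lemmas id_comult_pure = SS.tensor_lift_pure[OF id_comult_lift, folded id_comult_def]

text \<open>Comultiplying the first leg replaces its argument by the product a b; the associator
  only rebrackets and leaves the values unchanged.\<close>

lemma comult_id_eval:
  assumes "X \<in> carrier SS" "a \<in> carrier A" "b \<in> carrier A" "c \<in> carrier A"
  shows "eval3 (tensor_assoc \<R> \<R> S S S (comult_id X)) a b c = eval2 X (a \<otimes> b) c"
  using assms(1) by (induction rule: SS.tensor_induct)
    (use assms(2-) in \<open>simp_all add: comult_id_pure comult_id_add comult_id_closed assoc_pure assoc_add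
      assoc_closed assoc_left_eval comult_closed comult_eval eval2_pure eval2_add eval3_add\<close>)

lemma id_comult_eval:
  assumes "X \<in> carrier SS" "a \<in> carrier A" "b \<in> carrier A" "c \<in> carrier A"
  shows "eval3 (id_comult X) a b c = eval2 X a (b \<otimes> c)"
  using assms(1) by (induction rule: SS.tensor_induct)
    (use assms(2-) in \<open>simp_all add: id_comult_pure id_comult_add id_comult_closed
      comult_closed comult_eval eval2_pure eval2_add eval3_pure eval3_add\<close>)

text \<open>The two sides have the values \<alpha>((a b) c) and \<alpha>(a (b c)), so associativity
  of A suffices once tensors are separated by their values.\<close>

lemma coassociative:
  assumes "\<alpha> \<in> carrier S"
  shows "tensor_assoc \<R> \<R> S S S (tensor_map \<R> SS S (comult S) id (comult S \<alpha>)) =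
    tensor_map \<R> S SS id (comult S) (comult S \<alpha>)"
  unfolding tensor_map_comult
proof (rule eval3_inject)
  note cl = comult_closed[OF assms]
  show "tensor_assoc \<R> \<R> S S S (comult_id (comult S \<alpha>)) \<in> carrier SSS"
    by (intro assoc_closed comult_id_closed cl)
  show "id_comult (comult S \<alpha>) \<in> carrier SSS"
    by (intro id_comult_closed cl)
  fix a b c assume "a \<in> carrier A" "b \<in> carrier A" "c \<in> carrier A"
  then show "eval3 (tensor_assoc \<R> \<R> S S S (comult_id (comult S \<alpha>))) a b c =
      eval3 (id_comult (comult S \<alpha>)) a b c"
    by (simp add: comult_id_eval id_comult_eval cl comult_eval[OF assms] m_assoc)
qed

lemma coring_End_coring: "coring \<R> S"
  by (intro coring.intro coring_axioms.intro bimodule_S comult_bimodule_hom counit_bimodule_hom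
      coassociative counit_left counit_right)

end

theorem theorem3p4:
  fixes A :: "('a, 'x) ring_scheme" and B :: "'a set"
  assumes "ring A" and "subring B A"
    and "depth_two A B"
    and "centralizer A (centralizer A B) = B"
  shows "split_extension A B \<longleftrightarrow>
    cosplit_coring (A\<lparr>carrier := centralizer A B\<rparr>) (End_coring A B)"
proof -
  interpret ring_extension A B
    using assms(1,2) by (intro ring_extension.intro ring_extension_axioms.intro)
  obtain n \<gamma> u where "quasi_basis_extension A B n \<gamma> u"
  proof (rule depth_two_quasi_basis[OF assms(3)])
    fix n :: nat and \<gamma> u
    assume "\<And>j. j < n \<Longrightarrow> \<gamma> j \<in> carrier S" "\<And>j. j < n \<Longrightarrow> u j \<in> carrier AA"
      "\<And>j b. \<lbrakk>j < n; b \<in> B\<rbrakk> \<Longrightarrow> b \<odot>\<^bsub>AA\<^esub> u j = u j \<triangleleft>\<^bsub>AA\<^esub> b"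
      "\<And>a. a \<in> carrier A \<Longrightarrow> ptensor \<one>\<^bsub>A\<^esub> a = (\<Oplus>\<^bsub>AA\<^esub>j\<in>{..<n}. \<gamma> j a \<odot>\<^bsub>AA\<^esub> u j)"
    then have "quasi_basis_extension A B n \<gamma> u"
      by (intro quasi_basis_extension.intro quasi_basis_extension_axioms.intro ring_extension_axioms)
    then show thesis by (rule that)
  qed
  \<comment> \<open>Being cosplit includes being a coring, so the coring axioms must be available
    for the direction from split to cosplit.\<close>
  then have "coring \<R> S" by (rule quasi_basis_extension.coring_End_coring)
  then show ?thesis
    using split_imp_invariant cosplit_imp_split[OF assms(4)] by (auto simp: cosplit_coring_def)
qed

end
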